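(* Let $\alpha,\beta\in CBV^*[0,1]$ and $v,w\in CBV[0,1]$ satisfy $v(t)+w(t)=1$ for all $t\in[0,1]$ and $\|\alpha\|+\|\alpha-\beta\|\cdot\|w\|_{BV}<1$. Let $p\in(1,+\infty]$, $q\in[1,+\infty)$ with $p^{-1}+q^{-1}=1$. Let $f\colon[0,1]\times\mathbb R\to\mathbb R$ satisfy: $t\mapsto f(t,u)$ is Lebesgue measurable for every $u$; $u\mapsto f(t,u)$ is continuous for a.e. $t$; there exist a non-decreasing $\psi\colon[0,+\infty)\to[0,+\infty)$ and $\phi\in L^p([0,1])$, $\phi\ge0$, with $|f(t,u)|\le\phi(t)\psi(|u|)$ for all $t,u$; and $\lim_{r\to+\infty}\psi(r)/r=0$. Let $k\colon[0,1]^2\to\mathbb R$ satisfy: $s\mapsto k(t,s)$ is in $L^q([0,1])$ for every $t$; there is $m\in L^q([0,1])$, $m\ge0$, with $\operatorname{var}_{[0,1]}k(\cdot,s)\le m(s)$ for a.e. $s$; and $\lim_{t\to\tau}\int_0^1|k(t,s)-k(\tau,s)|\phi(s)\,ds=0$ for every $\tau\in[0,1]$. Then the equation $x(t)=\alpha[x]v(t)+\beta[x]w(t)+\int_0^1k(t,s)f(s,x(s))\,ds$, $t\in[0,1]$, has a solution $x\in CBV[0,1]$.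
   Context: $BV[0,1]$ is the Banach space of real functions of bounded Jordan variation on $[0,1]$ with norm $\|f\|_{BV}=|f(0)|+\operatorname{var}_{[0,1]}f$; $CBV[0,1]$ is its closed subspace of continuous functions, and $CBV^*[0,1]$ its dual with the operator norm $\|\cdot\|$. *)

theory Defs
  imports "HOL-Analysis.Analysis"
begin

definition partition_sum :: "(real \<Rightarrow> real) \<Rightarrow> real list \<Rightarrow> real" where
  "partition_sum f xs = (\<Sum>i<length xs - 1. \<bar>f (xs ! Suc i) - f (xs ! i)\<bar>)"

definition partitions :: "real \<Rightarrow> real \<Rightarrow> real list set" where
  "partitions a b = {xs. sorted xs \<and> set xs \<subseteq> {a..b}}"

definition bounded_variation :: "(real \<Rightarrow> real) \<Rightarrow> real \<Rightarrow> real \<Rightarrow> bool" where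
  "bounded_variation f a b \<longleftrightarrow> (\<exists>B. \<forall>xs\<in>partitions a b. partition_sum f xs \<le> B)"

text \<open>Total (Jordan) variation on [a,b] (meaningful when f has bounded variation).\<close>
definition total_variation :: "(real \<Rightarrow> real) \<Rightarrow> real \<Rightarrow> real \<Rightarrow> real" where
  "total_variation f a b = (SUP xs\<in>partitions a b. partition_sum f xs)"

definition BV_norm :: "(real \<Rightarrow> real) \<Rightarrow> real" where
  "BV_norm f = \<bar>f 0\<bar> + total_variation f 0 1"

text \<open>CBV[0,1]: continuous functions of bounded variation on [0,1]; functions are
  normalised to vanish outside [0,1] so that each element has a unique representative.\<close>
definition CBV :: "(real \<Rightarrow> real) set" where
  "CBV = {x. continuous_on {0..1} x \<and> bounded_variation x 0 1 \<and> (\<forall>t. t \<notin> {0..1} \<longrightarrow> x t = 0)}"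

definition CBV_dual :: "((real \<Rightarrow> real) \<Rightarrow> real) set" where
  "CBV_dual = {\<alpha>. (\<forall>x\<in>CBV. \<forall>y\<in>CBV. \<alpha> (\<lambda>t. x t + y t) = \<alpha> x + \<alpha> y)
     \<and> (\<forall>c. \<forall>x\<in>CBV. \<alpha> (\<lambda>t. c * x t) = c * \<alpha> x)
     \<and> (\<exists>C. \<forall>x\<in>CBV. \<bar>\<alpha> x\<bar> \<le> C * BV_norm x)}"

definition dual_norm :: "((real \<Rightarrow> real) \<Rightarrow> real) \<Rightarrow> real" where
  "dual_norm \<alpha> = (SUP x\<in>{x\<in>CBV. BV_norm x \<le> 1}. \<bar>\<alpha> x\<bar>)"

definition memLp :: "ereal \<Rightarrow> (real \<Rightarrow> real) \<Rightarrow> bool" where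
  "memLp p f \<longleftrightarrow> f \<in> borel_measurable (lebesgue_on {0..1}) \<and>
     (if p = \<infinity> then (\<exists>C. AE t in lebesgue_on {0..1}. \<bar>f t\<bar> \<le> C)
      else integrable (lebesgue_on {0..1}) (\<lambda>t. \<bar>f t\<bar> powr real_of_ereal p))"

end

theory Submission
  imports Defs "HOL-Complex_Analysis.Great_Picard"
begin

text \<open>
  Since v = 1 - w on [0,1], the equation reads x = \<alpha>[x] 1 + (\<beta> - \<alpha>)[x] w + K f(\<cdot>, x), where K is the
  integral operator with kernel k. Freezing the argument of f at the grid points i/n leaves finitely many
  unknowns: the values of x at the grid points and the two functionals. The smallness condition and the
  sublinear growth of \<psi> make a box in these coordinates invariant, so Brouwer's theorem gives an
  approximate solution with BV norm at most R, R independent of n. The images under K are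
  equicontinuous by the continuity condition on k, so Arzela-Ascoli yields a uniformly convergent
  subsequence; by dominated convergence f(\<cdot>, x_n) then converges in the weighted L1 space with weight
  |k(0,\<cdot>)| + m, which controls the BV norm of the image under K. Hence the approximations converge in
  BV norm, and one can pass to the limit in the functionals as well.
\<close>

section \<open>Brouwer's theorem for boxes indexed by natural numbers\<close>

text \<open>The number of coordinates grows with the grid, so the library's version for Euclidean types
  does not apply; its combinatorial core, Kuhn's lemma, is free of types.\<close>

lemma bounded_sequences_common_subsequence:
  fixes X :: "nat \<Rightarrow> nat \<Rightarrow> real"
  assumes "\<And>k i. i < n \<Longrightarrow> \<bar>X k i\<bar> \<le> B"
  obtains r where "strict_mono r" "\<And>i. i < n \<Longrightarrow> convergent (\<lambda>k. X (r k) i)"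
proof -
  have "\<exists>r. strict_mono r \<and> (\<forall>i<n. convergent (\<lambda>k. X (r k) i))"
    using assms
  proof (induction n)
    case 0
    show ?case by (rule exI[of _ id]) (auto simp: strict_mono_def)
  next
    case (Suc n)
    then obtain r where r: "strict_mono r" "\<forall>i<n. convergent (\<lambda>k. X (r k) i)"
      by force
    have "bounded (range (\<lambda>k. X (r k) n))"
      unfolding bounded_iff using Suc.prems[of n] by auto
    then obtain l r' where r': "strict_mono r'" "((\<lambda>k. X (r k) n) \<circ> r') \<longlonglongrightarrow> l"
      using bounded_imp_convergent_subsequence by blast
    have "convergent (\<lambda>k. X ((r \<circ> r') k) i)" if "i < Suc n" for i
    proof (cases "i = n")
      case True
      then show ?thesis using r'(2) by (auto simp: convergent_def o_def)
    next
      case False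
      then have "convergent ((\<lambda>k. X (r k) i) \<circ> r')"
        using r(2) that r'(1) by (intro convergent_subseq_convergent) auto
      then show ?thesis by (simp add: o_def)
    qed
    then show ?case
      using strict_mono_o[OF r(1) r'(1)] by blast
  qed
  then show ?thesis using that by blast
qed

text \<open>Label coordinate \<open>i\<close> of a point by 0 if \<open>F\<close> does not decrease
  it and by 1 if \<open>F\<close> does not increase it. Kuhn's lemma finds, in every grid, a cell on
  whose vertices each coordinate receives both labels. At a limit point of shrinking cells both
  inequalities hold, so the point is fixed. Continuity is sequential and sees the first
  \<open>n\<close> coordinates only, since no topology on \<open>nat \<Rightarrow> real\<close> is
  wanted.\<close>

lemma brouwer_unit_cube_nat:
  fixes F :: "(nat \<Rightarrow> real) \<Rightarrow> nat \<Rightarrow> real"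
  assumes maps: "\<And>x i. (\<And>j. j < n \<Longrightarrow> x j \<in> {0..1}) \<Longrightarrow> i < n \<Longrightarrow> F x i \<in> {0..1}"
    and cont: "\<And>X x i. (\<And>k j. j < n \<Longrightarrow> X k j \<in> {0..1}) \<Longrightarrow> (\<And>j. j < n \<Longrightarrow> x j \<in> {0..1}) \<Longrightarrow>
       (\<And>j. j < n \<Longrightarrow> (\<lambda>k. X k j) \<longlonglongrightarrow> x j) \<Longrightarrow> i < n \<Longrightarrow> (\<lambda>k. F (X k) i) \<longlonglongrightarrow> F x i"
  obtains x where "\<And>i. i < n \<Longrightarrow> x i \<in> {0..1}" "\<And>i. i < n \<Longrightarrow> F x i = x i"
proof -
  define P where "P x \<longleftrightarrow> (\<forall>i<n. x i \<in> {0..1})" for x :: "nat \<Rightarrow> real"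
  have "\<forall>x. P x \<longrightarrow> P (F x)" "\<forall>x. P x \<longrightarrow> (\<forall>i. i < n \<longrightarrow> 0 \<le> x i \<and> x i \<le> 1)"
    using maps unfolding P_def by (blast, simp)
  from kuhn_labelling_lemma'[of P F "\<lambda>i. i < n", OF this]
  obtain l :: "(nat \<Rightarrow> real) \<Rightarrow> nat \<Rightarrow> nat" where
    l01: "\<And>x i. l x i \<le> 1"
    and l0: "\<And>x i. P x \<Longrightarrow> i < n \<Longrightarrow> x i = 0 \<Longrightarrow> l x i = 0"
    and l1: "\<And>x i. P x \<Longrightarrow> i < n \<Longrightarrow> x i = 1 \<Longrightarrow> l x i = 1"
    and le: "\<And>x i. P x \<Longrightarrow> i < n \<Longrightarrow> l x i = 0 \<Longrightarrow> x i \<le> F x i"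
    and ge: "\<And>x i. P x \<Longrightarrow> i < n \<Longrightarrow> l x i = 1 \<Longrightarrow> F x i \<le> x i"
    by blast
  \<comment> \<open>\<open>G p\<close> places the integer grid with coordinates 0 to
    \<open>Suc p\<close> into the unit cube with mesh 1/(p+1).\<close>
  define G where "G p y = (\<lambda>i. real (y i) / real (Suc p))" for p and y :: "nat \<Rightarrow> nat"
  have G_P: "P (G p y)" if "\<forall>i<n. y i \<le> Suc p" for p y
    using that by (auto simp: P_def G_def divide_simps)
  \<comment> \<open>\<open>q\<close> is the lowest corner of a Kuhn cell; \<open>r i\<close> and
    \<open>s i\<close> are vertices of that cell whose labels in coordinate \<open>i\<close> are 0
    and 1.\<close>
  define W where "W p q r s \<longleftrightarrow> (\<forall>i<n. q i < Suc p) \<and>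
      (\<forall>i<n. (\<forall>j<n. q j \<le> r i j \<and> r i j \<le> q j + 1) \<and> (\<forall>j<n. q j \<le> s i j \<and> s i j \<le> q j + 1)
        \<and> l (G p (r i)) i = 0 \<and> l (G p (s i)) i = 1)" for p q r s
  have "\<exists>q r s. W p q r s" for p
  proof -
    obtain q where q: "\<forall>i<n. q i < Suc p"
      "\<forall>i<n. \<exists>r s. (\<forall>j<n. q j \<le> r j \<and> r j \<le> q j + 1) \<and> (\<forall>j<n. q j \<le> s j \<and> s j \<le> q j + 1)
         \<and> l (G p r) i \<noteq> l (G p s) i"
    proof (rule kuhn_lemma[of "Suc p" n "\<lambda>x. l (G p x)"])
      show "\<forall>x. (\<forall>i<n. x i \<le> Suc p) \<longrightarrow> (\<forall>i<n. l (G p x) i = 0 \<or> l (G p x) i = 1)"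
        using l01 by (metis le_neq_implies_less less_one)
      show "\<forall>x. (\<forall>i<n. x i \<le> Suc p) \<longrightarrow> (\<forall>i<n. x i = 0 \<longrightarrow> l (G p x) i = 0)"
        using G_P l0 by (auto simp: G_def)
      show "\<forall>x. (\<forall>i<n. x i \<le> Suc p) \<longrightarrow> (\<forall>i<n. x i = Suc p \<longrightarrow> l (G p x) i = 1)"
        using G_P l1 by (simp add: G_def)
    qed auto
    have "\<exists>r s. i < n \<longrightarrow> (\<forall>j<n. q j \<le> r j \<and> r j \<le> q j + 1) \<and> (\<forall>j<n. q j \<le> s j \<and> s j \<le> q j + 1)
         \<and> l (G p r) i = 0 \<and> l (G p s) i = 1" for i
    proof (cases "i < n")
      case True
      then obtain r s where rs: "\<forall>j<n. q j \<le> r j \<and> r j \<le> q j + 1" "\<forall>j<n. q j \<le> s j \<and> s j \<le> q j + 1"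
         "l (G p r) i \<noteq> l (G p s) i"
        using q(2) by blast
      \<comment> \<open>Kuhn's lemma only says that the two labels differ; the vertices are swapped
        if necessary so that \<open>r\<close> carries label 0.\<close>
      have "l (G p r) i = 0 \<and> l (G p s) i = 1 \<or> l (G p r) i = 1 \<and> l (G p s) i = 0"
        using rs(3) l01[of "G p r" i] l01[of "G p s" i] by linarith
      then show ?thesis using rs by blast
    qed simp
    then obtain r s where "\<And>i. i < n \<longrightarrow> (\<forall>j<n. q j \<le> r i j \<and> r i j \<le> q j + 1) \<and>
         (\<forall>j<n. q j \<le> s i j \<and> s i j \<le> q j + 1) \<and> l (G p (r i)) i = 0 \<and> l (G p (s i)) i = 1"
      by metis
    then show ?thesis using q(1) unfolding W_def by blast
  qed
  then obtain q r s where W: "\<And>p. W p (q p) (r p) (s p)"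
    by metis
  have q: "q p i < Suc p"
    and r: "j < n \<Longrightarrow> q p j \<le> r p i j \<and> r p i j \<le> q p j + 1"
    and s: "j < n \<Longrightarrow> q p j \<le> s p i j \<and> s p i j \<le> q p j + 1"
    and lr: "l (G p (r p i)) i = 0"
    and ls: "l (G p (s p i)) i = 1" if "i < n" for p i j
    using W[of p] that unfolding W_def by blast+
  have "\<bar>G p (q p) i\<bar> \<le> 1" if "i < n" for p i
    using q[OF that, of p] by (simp add: G_def)
  then obtain \<rho> where \<rho>: "strict_mono \<rho>" "\<And>i. i < n \<Longrightarrow> convergent (\<lambda>k. G (\<rho> k) (q (\<rho> k)) i)"
    using bounded_sequences_common_subsequence[of n "\<lambda>p. G p (q p)" 1] by blast
  define x where "x i = lim (\<lambda>k. G (\<rho> k) (q (\<rho> k)) i)" for i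
  have lim_q: "(\<lambda>k. G (\<rho> k) (q (\<rho> k)) i) \<longlonglongrightarrow> x i" if "i < n" for i
    using \<rho>(2)[OF that] by (simp add: x_def convergent_LIMSEQ_iff)
  have x01: "x i \<in> {0..1}" if "i < n" for i
  proof -
    have "P (G p (q p))" for p using q by (intro G_P) (simp add: less_imp_le)
    then have "G (\<rho> k) (q (\<rho> k)) i \<in> {0..1}" for k using that by (simp add: P_def)
    then show ?thesis using closed_sequentially[OF closed_atLeastAtMost _ lim_q[OF that]] by blast
  qed
  \<comment> \<open>Cells shrink with the mesh, so every choice of vertices converges to the limit
    of the corners.\<close>
  have close: "(\<lambda>k. G (\<rho> k) (y (\<rho> k)) j) \<longlonglongrightarrow> x j"
    if y: "\<And>p. q p j \<le> y p j \<and> y p j \<le> q p j + 1" and j: "j < n" for y j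
  proof (rule tendsto_sandwich[OF _ _ lim_q[OF j]])
    have "(\<lambda>k. inverse (real (Suc (\<rho> k)))) \<longlonglongrightarrow> 0"
      using LIMSEQ_subseq_LIMSEQ[OF LIMSEQ_inverse_real_of_nat \<rho>(1)] by (simp add: o_def)
    from tendsto_add[OF lim_q[OF j] this]
    show "(\<lambda>k. G (\<rho> k) (q (\<rho> k)) j + inverse (real (Suc (\<rho> k)))) \<longlonglongrightarrow> x j" by simp
    show "\<forall>\<^sub>F k in sequentially. G (\<rho> k) (q (\<rho> k)) j \<le> G (\<rho> k) (y (\<rho> k)) j"
      using y by (simp add: G_def divide_right_mono)
    have "real (y p j) / real (Suc p) \<le> real (q p j) / real (Suc p) + inverse (real (Suc p))" for p
      using y[of p] by (simp add: divide_simps)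
    then show "\<forall>\<^sub>F k in sequentially. G (\<rho> k) (y (\<rho> k)) j \<le> G (\<rho> k) (q (\<rho> k)) j + inverse (real (Suc (\<rho> k)))"
      by (simp add: G_def)
  qed
  have "F x i = x i" if i: "i < n" for i
  proof (rule antisym)
    \<comment> \<open>The strict bound \<open>q p j < Suc p\<close> leaves room for the upper
      neighbour \<open>q p j + 1\<close> inside the grid.\<close>
    have P: "P (G p (r p i))" "P (G p (s p i))" for p
      using r[OF i, of _ p] s[OF i, of _ p] q[of _ p] by (intro G_P; force)+
    have lim: "(\<lambda>k. G (\<rho> k) (r (\<rho> k) i) j) \<longlonglongrightarrow> x j" "(\<lambda>k. G (\<rho> k) (s (\<rho> k) i) j) \<longlonglongrightarrow> x j" if "j < n" for j
      using close[of j "\<lambda>p. r p i"] close[of j "\<lambda>p. s p i"] r[OF i that] s[OF i that] that by auto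
    have "(\<lambda>k. F (G (\<rho> k) (r (\<rho> k) i)) i) \<longlonglongrightarrow> F x i"
      by (rule cont) (use P x01 lim i in \<open>auto simp: P_def\<close>)
    then show "x i \<le> F x i"
      by (rule LIMSEQ_le[OF lim(1)[OF i]]) (use le[OF P(1) i] lr[OF i] in auto)
    have "(\<lambda>k. F (G (\<rho> k) (s (\<rho> k) i)) i) \<longlonglongrightarrow> F x i"
      by (rule cont) (use P x01 lim i in \<open>auto simp: P_def\<close>)
    then show "F x i \<le> x i"
      by (rule LIMSEQ_le[OF _ lim(2)[OF i]]) (use ge[OF P(2) i] ls[OF i] in auto)
  qed
  then show ?thesis using that x01 by blast
qed

text \<open>The unit cube case, transported by the affine map \<open>S\<close> from [0,1] to
  [-B i, B i] in each coordinate.\<close>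

lemma brouwer_box_nat:
  fixes F :: "(nat \<Rightarrow> real) \<Rightarrow> nat \<Rightarrow> real" and B :: "nat \<Rightarrow> real"
  assumes maps: "\<And>x i. (\<And>j. j < n \<Longrightarrow> \<bar>x j\<bar> \<le> B j) \<Longrightarrow> i < n \<Longrightarrow> \<bar>F x i\<bar> \<le> B i"
    and cont: "\<And>X x i. (\<And>k j. j < n \<Longrightarrow> \<bar>X k j\<bar> \<le> B j) \<Longrightarrow> (\<And>j. j < n \<Longrightarrow> \<bar>x j\<bar> \<le> B j) \<Longrightarrow>
       (\<And>j. j < n \<Longrightarrow> (\<lambda>k. X k j) \<longlonglongrightarrow> x j) \<Longrightarrow> i < n \<Longrightarrow> (\<lambda>k. F (X k) i) \<longlonglongrightarrow> F x i"
    and B: "\<And>i. i < n \<Longrightarrow> 0 \<le> B i"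
  obtains x where "\<And>i. i < n \<Longrightarrow> \<bar>x i\<bar> \<le> B i" "\<And>i. i < n \<Longrightarrow> F x i = x i"
proof -
  define S where "S y = (\<lambda>i. B i * (2 * y i - 1))" for y :: "nat \<Rightarrow> real"
  \<comment> \<open>A degenerate coordinate with B i = 0 is harmless: division by zero puts it at 1/2.\<close>
  define H where "H y i = (F (S y) i / B i + 1) / 2" for y i
  have S: "\<bar>S y j\<bar> \<le> B j" if "\<And>j. j < n \<Longrightarrow> y j \<in> {0..1}" "j < n" for y j
    using mult_left_mono[of "\<bar>2 * y j - 1\<bar>" 1 "B j"] B[OF that(2)] that(1)[OF that(2)]
    by (auto simp: S_def abs_mult)
  obtain y where y: "\<And>i. i < n \<Longrightarrow> y i \<in> {0..1}" "\<And>i. i < n \<Longrightarrow> H y i = y i"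
  proof (rule brouwer_unit_cube_nat[of n H])
    fix y :: "nat \<Rightarrow> real" and i assume y: "\<And>j. j < n \<Longrightarrow> y j \<in> {0..1}" and i: "i < n"
    have *: "\<bar>F (S y) i\<bar> \<le> B i" using maps S y i by blast
    have "F (S y) i / B i \<le> 1" "- 1 \<le> F (S y) i / B i"
      using * B[OF i] by (cases "B i = 0"; auto simp: divide_simps abs_le_iff)+
    then show "H y i \<in> {0..1}" by (simp add: H_def)
  next
    fix X :: "nat \<Rightarrow> nat \<Rightarrow> real" and y i
    assume "\<And>k j. j < n \<Longrightarrow> X k j \<in> {0..1}" "\<And>j. j < n \<Longrightarrow> y j \<in> {0..1}"
      and lim: "\<And>j. j < n \<Longrightarrow> (\<lambda>k. X k j) \<longlonglongrightarrow> y j" and i: "i < n"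
    then have "(\<lambda>k. F (S (X k)) i) \<longlonglongrightarrow> F (S y) i"
      by (intro cont S) (auto simp: S_def intro!: tendsto_intros)
    then have "(\<lambda>k. (F (S (X k)) i * inverse (B i) + 1) / 2) \<longlonglongrightarrow> (F (S y) i * inverse (B i) + 1) / 2"
      by (intro tendsto_intros) auto
    then show "(\<lambda>k. H (X k) i) \<longlonglongrightarrow> H y i"
      unfolding H_def divide_inverse .
  qed auto
  have "F (S y) i = S y i" if i: "i < n" for i
  \<comment> \<open>On a degenerate side the box condition alone forces both
    \<open>F (S y) i\<close> and \<open>S y i\<close> to be 0.\<close>
  proof (cases "B i = 0")
    case True
    then show ?thesis using maps[of "S y", OF S i] y(1) by (simp add: S_def)
  next
    case False
    then show ?thesis using y(2)[OF i] by (simp add: S_def H_def field_simps)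
  qed
  then show ?thesis using that[of "S y"] S y(1) by blast
qed

section \<open>Functions of bounded variation and their dual\<close>

lemma partition_sum_Nil [simp]: "partition_sum f [] = 0"
  by (simp add: partition_sum_def)

lemma Nil_in_partitions [simp]: "[] \<in> partitions a b"
  by (simp add: partitions_def)

lemma partition_sum_le_total_variation:
  "bounded_variation f a b \<Longrightarrow> xs \<in> partitions a b \<Longrightarrow> partition_sum f xs \<le> total_variation f a b"
  unfolding total_variation_def bounded_variation_def
  by (elim exE, rule cSUP_upper) (auto intro: bdd_aboveI2)

lemma total_variation_leI:
  "(\<And>xs. xs \<in> partitions a b \<Longrightarrow> partition_sum f xs \<le> B) \<Longrightarrow> total_variation f a b \<le> B"
  unfolding total_variation_def using Nil_in_partitions[of a b] by (blast intro: cSUP_least)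

lemma total_variation_nonneg: "bounded_variation f a b \<Longrightarrow> 0 \<le> total_variation f a b"
  using partition_sum_le_total_variation[of f a b "[]"] by simp

lemma partition_sum_add:
  "partition_sum (\<lambda>t. f t + g t) xs \<le> partition_sum f xs + partition_sum g xs"
  unfolding partition_sum_def sum.distrib[symmetric] by (intro sum_mono) linarith

lemma partition_sum_cmult: "partition_sum (\<lambda>t. c * f t) xs = \<bar>c\<bar> * partition_sum f xs"
  by (simp add: partition_sum_def sum_distrib_left abs_mult flip: right_diff_distrib)

lemma bounded_variation_add:
  assumes "bounded_variation f a b" "bounded_variation g a b"
  shows "bounded_variation (\<lambda>t. f t + g t) a b"
proof -
  obtain A B where "\<forall>xs\<in>partitions a b. partition_sum f xs \<le> A"
      "\<forall>xs\<in>partitions a b. partition_sum g xs \<le> B"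
    using assms unfolding bounded_variation_def by blast
  then have "\<forall>xs\<in>partitions a b. partition_sum (\<lambda>t. f t + g t) xs \<le> A + B"
    by (blast intro: add_mono order_trans[OF partition_sum_add])
  then show ?thesis unfolding bounded_variation_def by blast
qed

lemma bounded_variation_cmult:
  assumes "bounded_variation f a b" shows "bounded_variation (\<lambda>t. c * f t) a b"
  using assms unfolding bounded_variation_def partition_sum_cmult
  by (meson abs_ge_zero mult_left_mono)

lemma total_variation_add:
  assumes "bounded_variation f a b" "bounded_variation g a b"
  shows "total_variation (\<lambda>t. f t + g t) a b \<le> total_variation f a b + total_variation g a b"
  using assms by (intro total_variation_leI order_trans[OF partition_sum_add] add_mono
      partition_sum_le_total_variation)

lemma total_variation_cmult_le:
  assumes "bounded_variation f a b"
  shows "total_variation (\<lambda>t. c * f t) a b \<le> \<bar>c\<bar> * total_variation f a b"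
  using assms
  by (intro total_variation_leI)
     (simp add: partition_sum_cmult mult_left_mono partition_sum_le_total_variation)

section \<open>The space CBV[0,1] and its norm\<close>

lemma CBV_bounded_variation: "x \<in> CBV \<Longrightarrow> bounded_variation x 0 1"
  by (simp add: CBV_def)

lemma CBV_add: "x \<in> CBV \<Longrightarrow> y \<in> CBV \<Longrightarrow> (\<lambda>t. x t + y t) \<in> CBV"
  by (auto simp: CBV_def intro: continuous_on_add bounded_variation_add)

lemma CBV_cmult: "x \<in> CBV \<Longrightarrow> (\<lambda>t. c * x t) \<in> CBV"
  by (auto simp: CBV_def intro: continuous_on_mult_left bounded_variation_cmult)

lemma CBV_diff: "x \<in> CBV \<Longrightarrow> y \<in> CBV \<Longrightarrow> (\<lambda>t. x t - y t) \<in> CBV"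
  using CBV_add[OF _ CBV_cmult[of y "-1"]] by simp

text \<open>Elements of \<open>CBV\<close> vanish outside [0,1], so this indicator is the
  representative of the constant function 1, which is v + w in the equation.\<close>

lemma indicator_in_CBV: "indicator {0..1} \<in> CBV"
  and BV_norm_indicator: "BV_norm (indicator {0..1}) = 1"
proof -
  have *: "partition_sum (indicator {0..1}) xs = 0" if "xs \<in> partitions 0 1" for xs
  proof -
    have "indicator {0..1} (xs ! i) = (1::real)" if "i < length xs" for i
      using \<open>xs \<in> partitions 0 1\<close> nth_mem[OF that] by (auto simp: partitions_def indicator_def)
    then show ?thesis
      by (simp add: partition_sum_def)
  qed
  then have bv: "bounded_variation (indicator {0..1}) 0 1"
    by (auto simp: bounded_variation_def)
  have "continuous_on {0..1::real} (indicator {0..1} :: real \<Rightarrow> real)"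
    by (rule continuous_on_eq[OF continuous_on_const[of _ 1]]) simp
  with bv show "indicator {0..1} \<in> CBV" by (simp add: CBV_def)
  have "total_variation (indicator {0..1}) 0 1 \<le> 0"
    by (rule total_variation_leI) (simp add: *)
  with total_variation_nonneg[OF bv] show "BV_norm (indicator {0..1}) = 1"
    by (simp add: BV_norm_def)
qed

lemma BV_norm_nonneg: "x \<in> CBV \<Longrightarrow> 0 \<le> BV_norm x"
  by (simp add: BV_norm_def CBV_bounded_variation total_variation_nonneg)

lemma BV_norm_add: "x \<in> CBV \<Longrightarrow> y \<in> CBV \<Longrightarrow> BV_norm (\<lambda>t. x t + y t) \<le> BV_norm x + BV_norm y"
  using total_variation_add[of x 0 1 y] by (simp add: BV_norm_def CBV_bounded_variation)

lemma BV_norm_cmult_le: "x \<in> CBV \<Longrightarrow> BV_norm (\<lambda>t. c * x t) \<le> \<bar>c\<bar> * BV_norm x"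
  using total_variation_cmult_le[of x 0 1 c]
  by (simp add: BV_norm_def CBV_bounded_variation abs_mult distrib_left)

text \<open>The single increment from 0 to \<open>t\<close> is already bounded by the variation.
  Hence convergence in BV norm implies uniform convergence.\<close>

lemma abs_le_BV_norm:
  assumes "x \<in> CBV" shows "\<bar>x t\<bar> \<le> BV_norm x"
proof (cases "t \<in> {0..1}")
  case True
  then have "[0, t] \<in> partitions 0 1" by (simp add: partitions_def)
  from partition_sum_le_total_variation[OF CBV_bounded_variation[OF assms] this]
  have "\<bar>x t - x 0\<bar> \<le> total_variation x 0 1" by (simp add: partition_sum_def)
  then show ?thesis by (simp add: BV_norm_def)
next
  case False
  then show ?thesis using assms BV_norm_nonneg[OF assms] by (simp add: CBV_def)
qed

section \<open>Bounded functionals on CBV[0,1]\<close>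

lemma CBV_dual_add: "\<alpha> \<in> CBV_dual \<Longrightarrow> x \<in> CBV \<Longrightarrow> y \<in> CBV \<Longrightarrow> \<alpha> (\<lambda>t. x t + y t) = \<alpha> x + \<alpha> y"
  by (simp add: CBV_dual_def)

lemma CBV_dual_cmult: "\<alpha> \<in> CBV_dual \<Longrightarrow> x \<in> CBV \<Longrightarrow> \<alpha> (\<lambda>t. c * x t) = c * \<alpha> x"
  by (simp add: CBV_dual_def)

lemma CBV_dual_diff:
  assumes "\<alpha> \<in> CBV_dual" "x \<in> CBV" "y \<in> CBV" shows "\<alpha> (\<lambda>t. x t - y t) = \<alpha> x - \<alpha> y"
  using CBV_dual_add[OF assms(1,2) CBV_cmult[OF assms(3), of "-1"]]
    CBV_dual_cmult[OF assms(1,3), of "-1"] by simp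

lemma diff_in_CBV_dual:
  assumes "\<alpha> \<in> CBV_dual" "\<beta> \<in> CBV_dual" shows "(\<lambda>x. \<alpha> x - \<beta> x) \<in> CBV_dual"
proof -
  obtain C D where "\<forall>x\<in>CBV. \<bar>\<alpha> x\<bar> \<le> C * BV_norm x" "\<forall>x\<in>CBV. \<bar>\<beta> x\<bar> \<le> D * BV_norm x"
    using assms unfolding CBV_dual_def by auto
  then have "\<forall>x\<in>CBV. \<bar>\<alpha> x - \<beta> x\<bar> \<le> (C + D) * BV_norm x"
    unfolding distrib_right by (meson abs_triangle_ineq4 add_mono order_trans)
  then show ?thesis
    using assms unfolding CBV_dual_def by (auto simp: right_diff_distrib)
qed

text \<open>Scaling to the unit ball. As \<open>dual_norm\<close> is a supremum of reals, it has to
  be shown bounded above before it dominates any value; a function of norm 0 cannot be scaled and is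
  handled by the constant from \<open>CBV_dual\<close>.\<close>

lemma dual_norm_bound:
  assumes \<alpha>: "\<alpha> \<in> CBV_dual" and x: "x \<in> CBV"
  shows "\<bar>\<alpha> x\<bar> \<le> dual_norm \<alpha> * BV_norm x"
proof -
  obtain C where C: "\<And>x. x \<in> CBV \<Longrightarrow> \<bar>\<alpha> x\<bar> \<le> C * BV_norm x"
    using \<alpha> unfolding CBV_dual_def by blast
  show ?thesis
  proof (cases "BV_norm x = 0")
    case True
    then show ?thesis using C[OF x] by simp
  next
    case False
    then have pos: "0 < BV_norm x" using BV_norm_nonneg[OF x] by simp
    define y where "y = (\<lambda>t. inverse (BV_norm x) * x t)"
    have y: "y \<in> CBV" "BV_norm y \<le> 1"
      unfolding y_def using CBV_cmult[OF x] BV_norm_cmult_le[OF x, of "inverse (BV_norm x)"] pos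
      by auto
    \<comment> \<open>Passing to the absolute value of \<open>C\<close> makes the estimate monotone
      without first determining the sign of \<open>C\<close>.\<close>
    have "\<bar>\<alpha> z\<bar> \<le> \<bar>C\<bar>" if z: "z \<in> CBV" "BV_norm z \<le> 1" for z
    proof -
      have "C * BV_norm z \<le> \<bar>C\<bar> * 1"
        using z BV_norm_nonneg[OF z(1)] by (intro mult_mono) auto
      then show ?thesis using C[OF z(1)] by simp
    qed
    then have "\<bar>\<alpha> y\<bar> \<le> dual_norm \<alpha>"
      unfolding dual_norm_def using y by (intro cSUP_upper bdd_aboveI2[where M = "\<bar>C\<bar>"]) auto
    moreover have "\<alpha> x = BV_norm x * \<alpha> y"
      using CBV_dual_cmult[OF \<alpha> x, of "inverse (BV_norm x)"] pos by (simp add: y_def)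
    ultimately show ?thesis
      using pos by (simp add: abs_mult mult.commute)
  qed
qed

lemma dual_norm_nonneg: "\<alpha> \<in> CBV_dual \<Longrightarrow> 0 \<le> dual_norm \<alpha>"
  using dual_norm_bound[OF _ indicator_in_CBV, of \<alpha>] abs_ge_zero[of "\<alpha> (indicator {0..1})"]
  by (simp add: BV_norm_indicator)

lemma CBV_dual_tendsto:
  assumes "\<alpha> \<in> CBV_dual" "\<And>n. X n \<in> CBV" "x \<in> CBV"
    and lim: "(\<lambda>n. BV_norm (\<lambda>t. X n t - x t)) \<longlonglongrightarrow> 0"
  shows "(\<lambda>n. \<alpha> (X n)) \<longlonglongrightarrow> \<alpha> x"
proof (rule LIM_zero_cancel, rule Lim_null_comparison)
  show "\<forall>\<^sub>F n in sequentially. norm (\<alpha> (X n) - \<alpha> x) \<le> dual_norm \<alpha> * BV_norm (\<lambda>t. X n t - x t)"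
    using dual_norm_bound[OF assms(1) CBV_diff[OF assms(2,3)]] CBV_dual_diff[OF assms(1-3)] by simp
  show "(\<lambda>n. dual_norm \<alpha> * BV_norm (\<lambda>t. X n t - x t)) \<longlonglongrightarrow> 0"
    using tendsto_mult_right_zero[OF lim] .
qed

lemma BV_norm_tendsto_pointwise:
  assumes "\<And>n. X n \<in> CBV" "x \<in> CBV" "(\<lambda>n. BV_norm (\<lambda>t. X n t - x t)) \<longlonglongrightarrow> 0"
  shows "(\<lambda>n. X n t) \<longlonglongrightarrow> x t"
proof (rule LIM_zero_cancel, rule Lim_null_comparison[OF _ assms(3)])
  show "\<forall>\<^sub>F n in sequentially. norm (X n t - x t) \<le> BV_norm (\<lambda>t. X n t - x t)"
    using abs_le_BV_norm[OF CBV_diff[OF assms(1,2)]] by simp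
qed

section \<open>Measurability and integrability on the unit interval\<close>

text \<open>Completeness of Lebesgue measure; extension by zero moves the question from
  \<open>S\<close> to the whole line.\<close>

lemma lebesgue_on_borel_measurable_AE:
  fixes f g :: "real \<Rightarrow> real"
  assumes "S \<in> sets lebesgue" "f \<in> borel_measurable (lebesgue_on S)" "AE x in lebesgue_on S. f x = g x"
  shows "g \<in> borel_measurable (lebesgue_on S)"
proof -
  have "(\<lambda>x. if x \<in> S then g x else 0) \<in> borel_measurable lebesgue"
  proof (rule borel_measurable_AE)
    show "(\<lambda>x. if x \<in> S then f x else 0) \<in> borel_measurable lebesgue"
      using assms by (simp add: borel_measurable_if)
    show "AE x in lebesgue. (if x \<in> S then f x else 0) = (if x \<in> S then g x else 0)"
      using assms by (auto simp: AE_restrict_space_iff)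
  qed
  then show ?thesis using assms by (simp add: borel_measurable_if)
qed

text \<open>Provides the measurability of s \<mapsto> f(s, X(s)) later on, where continuity of f in
  its second argument, and hence convergence, is known only almost everywhere.\<close>

lemma lebesgue_on_borel_measurable_LIMSEQ_AE:
  fixes f :: "nat \<Rightarrow> real \<Rightarrow> real"
  assumes S: "S \<in> sets lebesgue" and f: "\<And>n. f n \<in> borel_measurable (lebesgue_on S)"
    and lim: "AE x in lebesgue_on S. (\<lambda>n. f n x) \<longlonglongrightarrow> g x"
  shows "g \<in> borel_measurable (lebesgue_on S)"
proof (rule lebesgue_on_borel_measurable_AE[OF S])
  show "(\<lambda>x. lim (\<lambda>n. f n x)) \<in> borel_measurable (lebesgue_on S)"
    using f by (rule borel_measurable_lim_metric)
  show "AE x in lebesgue_on S. lim (\<lambda>n. f n x) = g x"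
    using lim by eventually_elim (rule limI)
qed

text \<open>Only integrability is wanted, not the norm estimate of Hoelder's inequality, so Young's
  inequality gives an integrable majorant directly. For p = \<infinity> the majorant is an essential
  bound times the other factor.\<close>

lemma conjugate_exponents_integrable_mult:
  fixes p :: ereal and q :: real
  assumes p: "1 < p" and q: "1 \<le> q" and pq: "inverse p + ereal (1 / q) = 1"
    and \<phi>: "memLp p \<phi>" and g: "memLp (ereal q) g"
  shows "integrable (lebesgue_on {0..1}) (\<lambda>s. g s * \<phi> s)"
proof -
  have [measurable]: "\<phi> \<in> borel_measurable (lebesgue_on {0..1})" "g \<in> borel_measurable (lebesgue_on {0..1})"
    using \<phi> g by (auto simp: memLp_def)
  have gq: "integrable (lebesgue_on {0..1}) (\<lambda>t. \<bar>g t\<bar> powr q)"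
    using g by (simp add: memLp_def)
  show ?thesis
  proof (cases p)
    case PInf
    then have "q = 1" using pq q by (simp add: one_ereal_def)
    obtain C where C: "AE t in lebesgue_on {0..1}. \<bar>\<phi> t\<bar> \<le> C"
      using \<phi> PInf by (auto simp: memLp_def)
    have "integrable (lebesgue_on {0..1}) (\<lambda>s. C * \<bar>g s\<bar>)"
      using gq \<open>q = 1\<close> by simp
    then show ?thesis
    proof (rule Bochner_Integration.integrable_bound)
      show "AE s in lebesgue_on {0..1}. norm (g s * \<phi> s) \<le> norm (C * \<bar>g s\<bar>)"
        using C
      proof eventually_elim
        fix s assume "\<bar>\<phi> s\<bar> \<le> C"
        then have "\<bar>\<phi> s\<bar> * \<bar>g s\<bar> \<le> C * \<bar>g s\<bar>" by (rule mult_right_mono) simp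
        then show "norm (g s * \<phi> s) \<le> norm (C * \<bar>g s\<bar>)"
          using abs_ge_self[of "C * \<bar>g s\<bar>"] by (auto simp: abs_mult mult.commute)
      qed
    qed measurable
  next
    case (real r)
    then have r: "1 < r" using p by simp
    have conj: "1 / r + 1 / q = 1"
      using pq real r by (simp add: one_ereal_def inverse_eq_divide)
    \<comment> \<open>Young's inequality needs both exponents above 1; q = 1 would give 1/r = 0 for
      a finite r.\<close>
    have "q > 1"
    proof (rule ccontr)
      assume "\<not> q > 1"
      then have "q = 1" using q by simp
      then show False using conj r by simp
    qed
    have \<phi>r: "integrable (lebesgue_on {0..1}) (\<lambda>t. \<bar>\<phi> t\<bar> powr r)"
      using \<phi> real by (simp add: memLp_def)
    have "integrable (lebesgue_on {0..1}) (\<lambda>s. \<bar>\<phi> s\<bar> powr r / r + \<bar>g s\<bar> powr q / q)"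
      using \<phi>r gq by simp
    then show ?thesis
    proof (rule Bochner_Integration.integrable_bound)
      show "AE s in lebesgue_on {0..1}. norm (g s * \<phi> s) \<le> norm (\<bar>\<phi> s\<bar> powr r / r + \<bar>g s\<bar> powr q / q)"
      proof (rule AE_I2)
        fix s
        have "\<bar>\<phi> s\<bar> * \<bar>g s\<bar> \<le> \<bar>\<phi> s\<bar> powr r / r + \<bar>g s\<bar> powr q / q"
          using Youngs_inequality[OF r \<open>q > 1\<close> conj] by simp
        then show "norm (g s * \<phi> s) \<le> norm (\<bar>\<phi> s\<bar> powr r / r + \<bar>g s\<bar> powr q / q)"
          by (simp add: abs_mult mult.commute)
      qed
    qed measurable
  next
    case MInf
    then show ?thesis using p by simp
  qed
qed

section \<open>Integral operators with kernels of bounded variation\<close>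

abbreviation (input) unit_lebesgue :: "real measure" where
  "unit_lebesgue \<equiv> lebesgue_on {0..1}"

lemma AE_unit_lebesgueI: "(\<And>s. s \<in> {0..1} \<Longrightarrow> P s) \<Longrightarrow> AE s in unit_lebesgue. P s"
  by (rule AE_I2) simp

text \<open>Measurability apart, the exponents p and q enter only through the integrability of
  \<open>k t\<close> and \<open>m\<close> against \<phi>, so the locale records that
  instead.\<close>

locale bv_kernel =
  fixes k :: "real \<Rightarrow> real \<Rightarrow> real" and \<phi> m :: "real \<Rightarrow> real"
  assumes phi_nonneg: "\<And>s. s \<in> {0..1} \<Longrightarrow> 0 \<le> \<phi> s"
    and k_measurable: "\<And>t. t \<in> {0..1} \<Longrightarrow> k t \<in> borel_measurable unit_lebesgue"
    and m_measurable: "m \<in> borel_measurable unit_lebesgue"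
    and m_nonneg: "\<And>s. s \<in> {0..1} \<Longrightarrow> 0 \<le> m s"
    and k_phi_integrable: "\<And>t. t \<in> {0..1} \<Longrightarrow> integrable unit_lebesgue (\<lambda>s. k t s * \<phi> s)"
    and m_phi_integrable: "integrable unit_lebesgue (\<lambda>s. m s * \<phi> s)"
    and k_variation: "AE s in unit_lebesgue.
           bounded_variation (\<lambda>t. k t s) 0 1 \<and> total_variation (\<lambda>t. k t s) 0 1 \<le> m s"
    and k_continuous: "\<And>\<tau>. \<tau> \<in> {0..1} \<Longrightarrow>
           ((\<lambda>t. integral\<^sup>L unit_lebesgue (\<lambda>s. \<bar>k t s - k \<tau> s\<bar> * \<phi> s)) \<longlongrightarrow> 0) (at \<tau> within {0..1})"
begin

text \<open>Meant for the superpositions s \<mapsto> f(s, x(s)) with |x| at most R, for which the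
  growth condition gives M = \<psi>(R).\<close>

definition dominated :: "real \<Rightarrow> (real \<Rightarrow> real) \<Rightarrow> bool" where
  "dominated M g \<longleftrightarrow> g \<in> borel_measurable unit_lebesgue \<and> (\<forall>s\<in>{0..1}. \<bar>g s\<bar> \<le> M * \<phi> s)"

definition int_op :: "(real \<Rightarrow> real) \<Rightarrow> real \<Rightarrow> real" where
  "int_op g t = (if t \<in> {0..1} then integral\<^sup>L unit_lebesgue (\<lambda>s. k t s * g s) else 0)"

text \<open>For almost every \<open>s\<close> this bounds the BV norm of k(\<cdot>,s).\<close>

definition weight :: "real \<Rightarrow> real" where
  "weight s = \<bar>k 0 s\<bar> + m s"

definition weight_mass :: real where
  "weight_mass = integral\<^sup>L unit_lebesgue (\<lambda>s. weight s * \<phi> s)"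

lemma dominated_measurable: "dominated M g \<Longrightarrow> g \<in> borel_measurable unit_lebesgue"
  by (simp add: dominated_def)

lemma dominated_abs: "dominated M g \<Longrightarrow> dominated M (\<lambda>s. \<bar>g s\<bar>)"
  by (auto simp: dominated_def)

lemma dominated_diff:
  assumes "dominated M g" "dominated N h" shows "dominated (M + N) (\<lambda>s. g s - h s)"
  unfolding dominated_def
proof (intro conjI ballI)
  show "(\<lambda>s. g s - h s) \<in> borel_measurable unit_lebesgue"
    using assms by (auto simp: dominated_def)
  fix s :: real assume "s \<in> {0..1}"
  then have "\<bar>g s\<bar> \<le> M * \<phi> s" "\<bar>h s\<bar> \<le> N * \<phi> s" using assms by (auto simp: dominated_def)
  then show "\<bar>g s - h s\<bar> \<le> (M + N) * \<phi> s" by (simp add: distrib_right)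
qed

lemma dominated_mult_integrable:
  assumes h: "h \<in> borel_measurable unit_lebesgue" "integrable unit_lebesgue (\<lambda>s. h s * \<phi> s)"
    and g: "dominated M g"
  shows "integrable unit_lebesgue (\<lambda>s. h s * g s)"
proof -
  have "integrable unit_lebesgue (\<lambda>s. M * (h s * \<phi> s))"
    using h(2) by simp
  then show ?thesis
  proof (rule Bochner_Integration.integrable_bound)
    show "(\<lambda>s. h s * g s) \<in> borel_measurable unit_lebesgue"
      using h(1) dominated_measurable[OF g] by simp
    show "AE s in unit_lebesgue. norm (h s * g s) \<le> norm (M * (h s * \<phi> s))"
    proof (rule AE_unit_lebesgueI)
      fix s :: real assume "s \<in> {0..1}"
      then have "\<bar>g s\<bar> \<le> \<bar>M * \<phi> s\<bar>" using g by (force simp: dominated_def)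
      from mult_left_mono[OF this abs_ge_zero[of "h s"]]
      show "norm (h s * g s) \<le> norm (M * (h s * \<phi> s))" by (simp add: abs_mult mult_ac)
    qed
  qed
qed

lemma dominated_kernel_integrable:
  "t \<in> {0..1} \<Longrightarrow> dominated M g \<Longrightarrow> integrable unit_lebesgue (\<lambda>s. k t s * g s)"
  by (rule dominated_mult_integrable[OF k_measurable k_phi_integrable])

lemma kernel_diff_phi_integrable:
  assumes "t \<in> {0..1}" "\<tau> \<in> {0..1}"
  shows "integrable unit_lebesgue (\<lambda>s. \<bar>k t s - k \<tau> s\<bar> * \<phi> s)"
proof -
  have "integrable unit_lebesgue (\<lambda>s. \<bar>k t s * \<phi> s - k \<tau> s * \<phi> s\<bar>)"
    using assms by (intro integrable_abs Bochner_Integration.integrable_diff k_phi_integrable)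
  also have "?this \<longleftrightarrow> ?thesis"
    by (rule Bochner_Integration.integrable_cong[OF refl]) (auto simp: abs_mult phi_nonneg simp flip: left_diff_distrib)
  finally show ?thesis .
qed

lemma dominated_kernel_diff_integrable:
  assumes "t \<in> {0..1}" "\<tau> \<in> {0..1}" "dominated M g"
  shows "integrable unit_lebesgue (\<lambda>s. \<bar>k t s - k \<tau> s\<bar> * \<bar>g s\<bar>)"
  by (rule dominated_mult_integrable[OF _ kernel_diff_phi_integrable dominated_abs])
     (use assms k_measurable in auto)

section \<open>Continuity and variation of the images of the integral operator\<close>

lemma int_op_increment:
  assumes t: "t \<in> {0..1}" "\<tau> \<in> {0..1}" and g: "dominated M g"
  shows "\<bar>int_op g t - int_op g \<tau>\<bar> \<le> integral\<^sup>L unit_lebesgue (\<lambda>s. \<bar>k t s - k \<tau> s\<bar> * \<bar>g s\<bar>)"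
proof -
  have "int_op g t - int_op g \<tau> = integral\<^sup>L unit_lebesgue (\<lambda>s. k t s * g s - k \<tau> s * g s)"
    using t g by (simp add: int_op_def dominated_kernel_integrable)
  also have "\<bar>\<dots>\<bar> \<le> integral\<^sup>L unit_lebesgue (\<lambda>s. \<bar>k t s * g s - k \<tau> s * g s\<bar>)"
    by (rule integral_abs_bound)
  also have "\<dots> = integral\<^sup>L unit_lebesgue (\<lambda>s. \<bar>k t s - k \<tau> s\<bar> * \<bar>g s\<bar>)"
    by (simp add: abs_mult flip: left_diff_distrib)
  finally show ?thesis .
qed

text \<open>The bound depends on \<open>g\<close> only through \<open>M\<close>, so it yields
  equicontinuity of a whole family of images and not just continuity of each.\<close>

lemma int_op_modulus:
  assumes t: "t \<in> {0..1}" "\<tau> \<in> {0..1}" and g: "dominated M g"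
  shows "\<bar>int_op g t - int_op g \<tau>\<bar> \<le> M * integral\<^sup>L unit_lebesgue (\<lambda>s. \<bar>k t s - k \<tau> s\<bar> * \<phi> s)"
proof -
  have "integral\<^sup>L unit_lebesgue (\<lambda>s. \<bar>k t s - k \<tau> s\<bar> * \<bar>g s\<bar>)
      \<le> integral\<^sup>L unit_lebesgue (\<lambda>s. M * (\<bar>k t s - k \<tau> s\<bar> * \<phi> s))"
  proof (rule integral_mono)
    show "integrable unit_lebesgue (\<lambda>s. M * (\<bar>k t s - k \<tau> s\<bar> * \<phi> s))"
      using kernel_diff_phi_integrable[OF t] by simp
    fix s assume "s \<in> space unit_lebesgue"
    then have "\<bar>g s\<bar> \<le> M * \<phi> s" using g by (simp add: dominated_def)
    from mult_left_mono[OF this abs_ge_zero[of "k t s - k \<tau> s"]]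
    show "\<bar>k t s - k \<tau> s\<bar> * \<bar>g s\<bar> \<le> M * (\<bar>k t s - k \<tau> s\<bar> * \<phi> s)" by (simp add: mult_ac)
  qed (use dominated_kernel_diff_integrable[OF t g] in simp)
  then show ?thesis using int_op_increment[OF assms] by simp
qed

text \<open>After exchanging the finite sum with the integral, the kernel increments add up to a
  partition sum of k(\<cdot>,s), which is at most \<open>m s\<close> almost everywhere.\<close>

lemma int_op_partition_sum:
  assumes g: "dominated M g" and xs: "xs \<in> partitions 0 1"
  shows "partition_sum (int_op g) xs \<le> integral\<^sup>L unit_lebesgue (\<lambda>s. m s * \<bar>g s\<bar>)"
proof -
  have xs01: "xs ! i \<in> {0..1}" if "i < length xs" for i
    using xs nth_mem[OF that] by (auto simp: partitions_def)
  have int: "integrable unit_lebesgue (\<lambda>s. \<bar>k (xs ! Suc i) s - k (xs ! i) s\<bar> * \<bar>g s\<bar>)"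
    if "i < length xs - 1" for i
    using that by (intro dominated_kernel_diff_integrable[OF _ _ g] xs01) auto
  have "partition_sum (int_op g) xs
      \<le> (\<Sum>i<length xs - 1. integral\<^sup>L unit_lebesgue (\<lambda>s. \<bar>k (xs ! Suc i) s - k (xs ! i) s\<bar> * \<bar>g s\<bar>))"
    unfolding partition_sum_def by (intro sum_mono int_op_increment[OF _ _ g] xs01) auto
  also have "\<dots> = integral\<^sup>L unit_lebesgue (\<lambda>s. \<Sum>i<length xs - 1. \<bar>k (xs ! Suc i) s - k (xs ! i) s\<bar> * \<bar>g s\<bar>)"
    using int by (intro Bochner_Integration.integral_sum[symmetric]) auto
  also have "\<dots> \<le> integral\<^sup>L unit_lebesgue (\<lambda>s. m s * \<bar>g s\<bar>)"
  proof (rule integral_mono_AE)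
    show "integrable unit_lebesgue (\<lambda>s. \<Sum>i<length xs - 1. \<bar>k (xs ! Suc i) s - k (xs ! i) s\<bar> * \<bar>g s\<bar>)"
      using int by (intro Bochner_Integration.integrable_sum) auto
    show "integrable unit_lebesgue (\<lambda>s. m s * \<bar>g s\<bar>)"
      by (rule dominated_mult_integrable[OF m_measurable m_phi_integrable dominated_abs[OF g]])
    show "AE s in unit_lebesgue. (\<Sum>i<length xs - 1. \<bar>k (xs ! Suc i) s - k (xs ! i) s\<bar> * \<bar>g s\<bar>) \<le> m s * \<bar>g s\<bar>"
      using k_variation
    proof eventually_elim
      fix s assume s: "bounded_variation (\<lambda>t. k t s) 0 1 \<and> total_variation (\<lambda>t. k t s) 0 1 \<le> m s"
      then have "partition_sum (\<lambda>t. k t s) xs \<le> m s"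
        using partition_sum_le_total_variation xs by force
      from mult_right_mono[OF this abs_ge_zero[of "g s"]]
      show "(\<Sum>i<length xs - 1. \<bar>k (xs ! Suc i) s - k (xs ! i) s\<bar> * \<bar>g s\<bar>) \<le> m s * \<bar>g s\<bar>"
        by (simp add: partition_sum_def sum_distrib_right)
    qed
  qed
  finally show ?thesis .
qed

lemma int_op_in_CBV:
  assumes g: "dominated M g" shows "int_op g \<in> CBV"
proof -
  have "bounded_variation (int_op g) 0 1"
    unfolding bounded_variation_def using int_op_partition_sum[OF g] by blast
  moreover have "continuous_on {0..1} (int_op g)"
    unfolding continuous_on_def
  proof
    fix \<tau> :: real assume \<tau>: "\<tau> \<in> {0..1}"
    show "(int_op g \<longlongrightarrow> int_op g \<tau>) (at \<tau> within {0..1})"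
    proof (rule LIM_zero_cancel, rule Lim_null_comparison)
      show "\<forall>\<^sub>F t in at \<tau> within {0..1}. norm (int_op g t - int_op g \<tau>)
          \<le> M * integral\<^sup>L unit_lebesgue (\<lambda>s. \<bar>k t s - k \<tau> s\<bar> * \<phi> s)"
        using int_op_modulus[OF _ \<tau> g] by (auto simp: eventually_at_filter)
      show "((\<lambda>t. M * integral\<^sup>L unit_lebesgue (\<lambda>s. \<bar>k t s - k \<tau> s\<bar> * \<phi> s)) \<longlongrightarrow> 0) (at \<tau> within {0..1})"
        by (rule tendsto_mult_right_zero[OF k_continuous[OF \<tau>]])
    qed
  qed
  ultimately show ?thesis by (simp add: CBV_def int_op_def)
qed

section \<open>Weighted L1 control of the BV norm\<close>

lemma weight_measurable: "weight \<in> borel_measurable unit_lebesgue"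
  unfolding weight_def using k_measurable[of 0] m_measurable by simp

lemma weight_nonneg: "s \<in> {0..1} \<Longrightarrow> 0 \<le> weight s"
  by (simp add: weight_def m_nonneg)

lemma weight_phi_integrable: "integrable unit_lebesgue (\<lambda>s. weight s * \<phi> s)"
proof -
  have "integrable unit_lebesgue (\<lambda>s. \<bar>k 0 s * \<phi> s\<bar> + m s * \<phi> s)"
    using k_phi_integrable[of 0] m_phi_integrable by simp
  also have "?this \<longleftrightarrow> ?thesis"
    by (rule Bochner_Integration.integrable_cong[OF refl]) (auto simp: abs_mult phi_nonneg weight_def distrib_right)
  finally show ?thesis .
qed

lemma weight_mass_nonneg: "0 \<le> weight_mass"
  unfolding weight_mass_def
  by (intro integral_nonneg_AE AE_unit_lebesgueI mult_nonneg_nonneg weight_nonneg phi_nonneg)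

lemma weight_integrable: "dominated M g \<Longrightarrow> integrable unit_lebesgue (\<lambda>s. weight s * \<bar>g s\<bar>)"
  by (rule dominated_mult_integrable[OF weight_measurable weight_phi_integrable dominated_abs])

text \<open>The value at 0 costs the integral against |k(0,\<cdot>)| and the variation the integral
  against \<open>m\<close>. Keeping |g| here, rather than its majorant, is what makes the bound
  small for small differences.\<close>

lemma BV_norm_int_op:
  assumes g: "dominated M g"
  shows "BV_norm (int_op g) \<le> integral\<^sup>L unit_lebesgue (\<lambda>s. weight s * \<bar>g s\<bar>)"
proof -
  have k0: "integrable unit_lebesgue (\<lambda>s. k 0 s * g s)"
    using dominated_kernel_integrable[OF _ g] by simp
  have "\<bar>int_op g 0\<bar> \<le> integral\<^sup>L unit_lebesgue (\<lambda>s. \<bar>k 0 s * g s\<bar>)"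
    by (simp add: int_op_def integral_abs_bound)
  moreover have "total_variation (int_op g) 0 1 \<le> integral\<^sup>L unit_lebesgue (\<lambda>s. m s * \<bar>g s\<bar>)"
    by (rule total_variation_leI[OF int_op_partition_sum[OF g]])
  moreover have "integral\<^sup>L unit_lebesgue (\<lambda>s. weight s * \<bar>g s\<bar>) =
      integral\<^sup>L unit_lebesgue (\<lambda>s. \<bar>k 0 s * g s\<bar>) + integral\<^sup>L unit_lebesgue (\<lambda>s. m s * \<bar>g s\<bar>)"
    unfolding weight_def distrib_right abs_mult
    by (rule Bochner_Integration.integral_add)
       (use integrable_abs[OF k0] dominated_mult_integrable[OF m_measurable m_phi_integrable dominated_abs[OF g]]
        in \<open>simp_all add: abs_mult\<close>)
  ultimately show ?thesis by (simp add: BV_norm_def)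
qed

lemma BV_norm_int_op_le:
  assumes g: "dominated M g" shows "BV_norm (int_op g) \<le> M * weight_mass"
proof -
  have "integral\<^sup>L unit_lebesgue (\<lambda>s. weight s * \<bar>g s\<bar>) \<le> integral\<^sup>L unit_lebesgue (\<lambda>s. M * (weight s * \<phi> s))"
  proof (rule integral_mono[OF weight_integrable[OF g]])
    show "integrable unit_lebesgue (\<lambda>s. M * (weight s * \<phi> s))"
      using weight_phi_integrable by simp
    fix s assume "s \<in> space unit_lebesgue"
    then have "\<bar>g s\<bar> \<le> M * \<phi> s" "0 \<le> weight s" using g weight_nonneg by (auto simp: dominated_def)
    from mult_left_mono[OF this]
    show "weight s * \<bar>g s\<bar> \<le> M * (weight s * \<phi> s)" by (simp add: mult_ac)
  qed
  then show ?thesis using BV_norm_int_op[OF g] by (simp add: weight_mass_def)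
qed

lemma int_op_diff:
  assumes "dominated M g" "dominated N h"
  shows "int_op (\<lambda>s. g s - h s) t = int_op g t - int_op h t"
proof (cases "t \<in> {0..1}")
  case True
  have "integral\<^sup>L unit_lebesgue (\<lambda>s. k t s * g s - k t s * h s)
      = integral\<^sup>L unit_lebesgue (\<lambda>s. k t s * g s) - integral\<^sup>L unit_lebesgue (\<lambda>s. k t s * h s)"
    by (rule Bochner_Integration.integral_diff[OF dominated_kernel_integrable[OF True assms(1)]
          dominated_kernel_integrable[OF True assms(2)]])
  with True show ?thesis
    by (simp only: int_op_def right_diff_distrib if_True)
next
  case False
  then show ?thesis by (simp only: int_op_def if_False)
qed

text \<open>Almost everywhere convergence of the integrands is upgraded to BV convergence of the
  images: the weighted L1 distance controls the BV distance and tends to 0 by dominated convergence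
  with majorant 2 M \<open>weight\<close> \<phi>.\<close>

lemma int_op_tendsto:
  assumes G: "\<And>n. dominated M (G n)" and g: "dominated M g"
    and lim: "AE s in unit_lebesgue. (\<lambda>n. G n s) \<longlonglongrightarrow> g s"
  shows "(\<lambda>n. BV_norm (\<lambda>t. int_op (G n) t - int_op g t)) \<longlonglongrightarrow> 0"
proof -
  have dom: "dominated (M + M) (\<lambda>s. G n s - g s)" for n
    using dominated_diff[OF G g] .
  have "(\<lambda>n. integral\<^sup>L unit_lebesgue (\<lambda>s. weight s * \<bar>G n s - g s\<bar>)) \<longlonglongrightarrow> integral\<^sup>L unit_lebesgue (\<lambda>s. 0)"
  proof (rule integral_dominated_convergence[where w = "\<lambda>s. (M + M) * (weight s * \<phi> s)"])
    show "(\<lambda>s. weight s * \<bar>G n s - g s\<bar>) \<in> borel_measurable unit_lebesgue" for n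
      using weight_integrable[OF dom] by (rule borel_measurable_integrable)
    show "integrable unit_lebesgue (\<lambda>s. (M + M) * (weight s * \<phi> s))"
      using weight_phi_integrable by simp
    show "AE s in unit_lebesgue. (\<lambda>n. weight s * \<bar>G n s - g s\<bar>) \<longlonglongrightarrow> 0"
      using lim
    proof eventually_elim
      fix s assume "(\<lambda>n. G n s) \<longlonglongrightarrow> g s"
      then show "(\<lambda>n. weight s * \<bar>G n s - g s\<bar>) \<longlonglongrightarrow> 0"
        by (intro tendsto_mult_right_zero tendsto_rabs_zero LIM_zero)
    qed
    show "AE s in unit_lebesgue. norm (weight s * \<bar>G n s - g s\<bar>) \<le> (M + M) * (weight s * \<phi> s)" for n
    proof (rule AE_unit_lebesgueI)
      fix s :: real assume "s \<in> {0..1}"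
      then have "\<bar>G n s - g s\<bar> \<le> (M + M) * \<phi> s" "0 \<le> weight s"
        using dom[of n] weight_nonneg by (auto simp: dominated_def)
      from mult_left_mono[OF this] \<open>0 \<le> weight s\<close>
      show "norm (weight s * \<bar>G n s - g s\<bar>) \<le> (M + M) * (weight s * \<phi> s)"
        by (simp add: abs_mult mult_ac)
    qed
  qed simp
  then have lim0: "(\<lambda>n. integral\<^sup>L unit_lebesgue (\<lambda>s. weight s * \<bar>G n s - g s\<bar>)) \<longlonglongrightarrow> 0"
    by simp
  have eq: "int_op (\<lambda>s. G n s - g s) = (\<lambda>t. int_op (G n) t - int_op g t)" for n
    by (rule ext) (rule int_op_diff[OF G g])
  show ?thesis
  proof (rule tendsto_sandwich[OF _ _ tendsto_const lim0])
    show "\<forall>\<^sub>F n in sequentially. BV_norm (\<lambda>t. int_op (G n) t - int_op g t)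
        \<le> integral\<^sup>L unit_lebesgue (\<lambda>s. weight s * \<bar>G n s - g s\<bar>)"
      using BV_norm_int_op[OF dom] unfolding eq by (intro always_eventually allI)
    show "\<forall>\<^sub>F n in sequentially. 0 \<le> BV_norm (\<lambda>t. int_op (G n) t - int_op g t)"
      by (intro always_eventually allI BV_norm_nonneg CBV_diff int_op_in_CBV[OF G] int_op_in_CBV[OF g])
  qed
qed

end

section \<open>Discretisation and passage to the limit\<close>

text \<open>For s in [0,1] and n > 0, \<open>node n s / n\<close> is the last grid point not
  exceeding s; at s = 1 it is the endpoint itself.\<close>

definition node :: "nat \<Rightarrow> real \<Rightarrow> nat" where
  "node n s = nat \<lfloor>real n * s\<rfloor>"

lemma node_le: "s \<in> {0..1} \<Longrightarrow> node n s \<le> n"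
  unfolding node_def using mult_left_le[of s "real n"] by (simp add: nat_le_iff floor_le_iff)

lemma node_tendsto:
  assumes s: "s \<in> {0..1}" and r: "strict_mono r"
  shows "(\<lambda>j. real (node (Suc (r j)) s) / real (Suc (r j))) \<longlonglongrightarrow> s"
proof -
  have inv: "(\<lambda>j. inverse (real (Suc (r j)))) \<longlonglongrightarrow> 0"
    using LIMSEQ_subseq_LIMSEQ[OF LIMSEQ_inverse_real_of_nat r] by (simp add: o_def)
  have lower: "s - inverse (real (Suc n)) \<le> real (node (Suc n) s) / real (Suc n)"
    and upper: "real (node (Suc n) s) / real (Suc n) \<le> s" for n
  proof -
    have fl: "real (node (Suc n) s) = real_of_int \<lfloor>real (Suc n) * s\<rfloor>"
      using s by (simp add: node_def)
    have "real (Suc n) * s - 1 \<le> real_of_int \<lfloor>real (Suc n) * s\<rfloor>" by linarith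
    then have "(real (Suc n) * s - 1) / real (Suc n) \<le> real (node (Suc n) s) / real (Suc n)"
      unfolding fl by (rule divide_right_mono) simp
    then show "s - inverse (real (Suc n)) \<le> real (node (Suc n) s) / real (Suc n)"
      by (simp add: diff_divide_distrib inverse_eq_divide del: of_nat_Suc)
    have "real_of_int \<lfloor>real (Suc n) * s\<rfloor> \<le> real (Suc n) * s" by linarith
    then show "real (node (Suc n) s) / real (Suc n) \<le> s"
      unfolding fl by (simp add: field_simps del: of_nat_Suc)
  qed
  show ?thesis
  proof (rule tendsto_sandwich)
    show "(\<lambda>j. s - inverse (real (Suc (r j)))) \<longlonglongrightarrow> s"
      using tendsto_diff[OF tendsto_const inv] by simp
    show "(\<lambda>j. s) \<longlonglongrightarrow> s" by simp
  qed (use lower upper in auto)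
qed

text \<open>The equation rewritten with general functionals and functions; it is used with \<alpha>
  and \<beta> - \<alpha> as functionals and with 1 and w as functions. The assumption
  \<open>invariant\<close> says that the a priori estimate on the ball of radius \<open>R\<close>
  returns to that ball.\<close>

locale hammerstein_equation = bv_kernel +
  fixes f :: "real \<Rightarrow> real \<Rightarrow> real" and \<gamma>\<^sub>1 \<gamma>\<^sub>2 :: "(real \<Rightarrow> real) \<Rightarrow> real"
    and e\<^sub>1 e\<^sub>2 :: "real \<Rightarrow> real" and M R :: real
  assumes dual: "\<gamma>\<^sub>1 \<in> CBV_dual" "\<gamma>\<^sub>2 \<in> CBV_dual"
    and CBV: "e\<^sub>1 \<in> CBV" "e\<^sub>2 \<in> CBV"
    and R_nonneg: "0 \<le> R"
    and f_measurable: "\<And>u. (\<lambda>s. f s u) \<in> borel_measurable unit_lebesgue"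
    and f_continuous: "AE s in unit_lebesgue. continuous_on UNIV (f s)"
    and f_dominated: "\<And>s u. s \<in> {0..1} \<Longrightarrow> \<bar>u\<bar> \<le> R \<Longrightarrow> \<bar>f s u\<bar> \<le> M * \<phi> s"
    and invariant: "dual_norm \<gamma>\<^sub>1 * R * BV_norm e\<^sub>1 + dual_norm \<gamma>\<^sub>2 * R * BV_norm e\<^sub>2 + M * weight_mass \<le> R"
begin

text \<open>The right-hand side with the two functional values and the superposition decoupled from
  the unknown, so that each can be approximated separately. All terms vanish outside [0,1].\<close>

definition trial :: "real \<Rightarrow> real \<Rightarrow> (real \<Rightarrow> real) \<Rightarrow> real \<Rightarrow> real" where
  "trial a b g t = a * e\<^sub>1 t + b * e\<^sub>2 t + int_op g t"

lemma trial_in_CBV: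
  assumes "dominated N g" shows "trial a b g \<in> CBV"
proof -
  have "(\<lambda>t. a * e\<^sub>1 t + b * e\<^sub>2 t + int_op g t) \<in> CBV"
    by (intro CBV_add CBV_cmult CBV int_op_in_CBV[OF assms])
  moreover have "(\<lambda>t. a * e\<^sub>1 t + b * e\<^sub>2 t + int_op g t) = trial a b g"
    by (rule ext) (simp add: trial_def)
  ultimately show ?thesis by simp
qed

lemma BV_norm_combination:
  assumes y: "y \<in> CBV"
  shows "BV_norm (\<lambda>t. a * e\<^sub>1 t + b * e\<^sub>2 t + y t) \<le> \<bar>a\<bar> * BV_norm e\<^sub>1 + \<bar>b\<bar> * BV_norm e\<^sub>2 + BV_norm y"
proof -
  have "BV_norm (\<lambda>t. a * e\<^sub>1 t + b * e\<^sub>2 t + y t)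
      \<le> BV_norm (\<lambda>t. a * e\<^sub>1 t + b * e\<^sub>2 t) + BV_norm y"
    by (rule BV_norm_add[OF CBV_add[OF CBV_cmult[OF CBV(1)] CBV_cmult[OF CBV(2)]] y])
  moreover have "BV_norm (\<lambda>t. a * e\<^sub>1 t + b * e\<^sub>2 t) \<le> BV_norm (\<lambda>t. a * e\<^sub>1 t) + BV_norm (\<lambda>t. b * e\<^sub>2 t)"
    by (rule BV_norm_add[OF CBV_cmult[OF CBV(1)] CBV_cmult[OF CBV(2)]])
  ultimately show ?thesis
    using BV_norm_cmult_le[OF CBV(1), of a] BV_norm_cmult_le[OF CBV(2), of b] by linarith
qed

lemma BV_norm_trial_le:
  assumes "\<bar>a\<bar> \<le> dual_norm \<gamma>\<^sub>1 * R" "\<bar>b\<bar> \<le> dual_norm \<gamma>\<^sub>2 * R" "dominated M g"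
  shows "BV_norm (trial a b g) \<le> R"
proof -
  have "BV_norm (trial a b g) \<le> \<bar>a\<bar> * BV_norm e\<^sub>1 + \<bar>b\<bar> * BV_norm e\<^sub>2 + BV_norm (int_op g)"
    using BV_norm_combination[OF int_op_in_CBV[OF assms(3)], of a b] by (simp add: trial_def[abs_def])
  moreover have "\<bar>a\<bar> * BV_norm e\<^sub>1 \<le> dual_norm \<gamma>\<^sub>1 * R * BV_norm e\<^sub>1"
    by (rule mult_right_mono[OF assms(1) BV_norm_nonneg[OF CBV(1)]])
  moreover have "\<bar>b\<bar> * BV_norm e\<^sub>2 \<le> dual_norm \<gamma>\<^sub>2 * R * BV_norm e\<^sub>2"
    by (rule mult_right_mono[OF assms(2) BV_norm_nonneg[OF CBV(2)]])
  ultimately show ?thesis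
    using BV_norm_int_op_le[OF assms(3)] invariant by linarith
qed

lemma trial_tendsto:
  assumes a: "A \<longlonglongrightarrow> a" and b: "B \<longlonglongrightarrow> b" and G: "\<And>n. dominated M (G n)" and g: "dominated M g"
    and lim: "AE s in unit_lebesgue. (\<lambda>n. G n s) \<longlonglongrightarrow> g s"
  shows "(\<lambda>n. BV_norm (\<lambda>t. trial (A n) (B n) (G n) t - trial a b g t)) \<longlonglongrightarrow> 0"
proof -
  define D where "D n = (\<lambda>t. int_op (G n) t - int_op g t)" for n
  have D: "D n \<in> CBV" for n
    unfolding D_def by (intro CBV_diff int_op_in_CBV[OF G] int_op_in_CBV[OF g])
  have eq: "(\<lambda>t. trial (A n) (B n) (G n) t - trial a b g t) =
      (\<lambda>t. (A n - a) * e\<^sub>1 t + (B n - b) * e\<^sub>2 t + D n t)" for n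
    by (rule ext) (simp add: trial_def D_def algebra_simps)
  have D0: "(\<lambda>n. BV_norm (D n)) \<longlonglongrightarrow> 0"
    unfolding D_def by (rule int_op_tendsto[OF G g lim])
  have lim0: "(\<lambda>n. \<bar>A n - a\<bar> * BV_norm e\<^sub>1 + \<bar>B n - b\<bar> * BV_norm e\<^sub>2 + BV_norm (D n)) \<longlonglongrightarrow> 0"
    by (intro tendsto_add_zero tendsto_mult_left_zero tendsto_rabs_zero LIM_zero a b D0)
  show ?thesis
  proof (rule tendsto_sandwich[OF _ _ tendsto_const lim0])
    show "\<forall>\<^sub>F n in sequentially. BV_norm (\<lambda>t. trial (A n) (B n) (G n) t - trial a b g t)
        \<le> \<bar>A n - a\<bar> * BV_norm e\<^sub>1 + \<bar>B n - b\<bar> * BV_norm e\<^sub>2 + BV_norm (D n)"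
      unfolding eq by (intro always_eventually allI BV_norm_combination D)
    show "\<forall>\<^sub>F n in sequentially. 0 \<le> BV_norm (\<lambda>t. trial (A n) (B n) (G n) t - trial a b g t)"
      by (intro always_eventually allI BV_norm_nonneg CBV_diff trial_in_CBV[OF G] trial_in_CBV[OF g])
  qed
qed

text \<open>\<open>node n\<close> takes countably many values, so the function is glued from the
  measurable sections of \<open>f\<close>; this is why the arguments are frozen on a grid.\<close>

lemma superposition_node_measurable:
  "(\<lambda>s. f s (c (node n s))) \<in> borel_measurable unit_lebesgue"
proof (rule measurable_compose_countable[where f = "\<lambda>i s. f s (c i)" and g = "node n"])
  show "(\<lambda>s. f s (c i)) \<in> borel_measurable unit_lebesgue" for i by (rule f_measurable)
  have [measurable]: "(\<lambda>s. s) \<in> borel_measurable unit_lebesgue"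
    using id_borel_measurable_lebesgue_on by (simp add: id_def)
  show "node n \<in> measurable unit_lebesgue (count_space UNIV)"
    unfolding node_def[abs_def] by measurable
qed

lemma superposition_node_dominated:
  assumes "\<And>i. i \<le> n \<Longrightarrow> \<bar>c i\<bar> \<le> R"
  shows "dominated M (\<lambda>s. f s (c (node n s)))"
  unfolding dominated_def using superposition_node_measurable f_dominated assms node_le by blast

lemma discretised_solution:
  assumes n: "0 < n"
  obtains x where "x \<in> CBV" "BV_norm x \<le> R"
    "x = trial (\<gamma>\<^sub>1 x) (\<gamma>\<^sub>2 x) (\<lambda>s. f s (x (real (node n s) / real n)))"
proof -
  \<comment> \<open>Coordinates 0..n hold the values of x at the grid points i/n, and coordinates n+1 and n+2 the values of the two functionals at x.\<close>
  define x where "x c = trial (c (n+1)) (c (n+2)) (\<lambda>s. f s (c (node n s)))" for c :: "nat \<Rightarrow> real"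
  define F where "F c i = (if i \<le> n then x c (real i / real n) else if i = n+1 then \<gamma>\<^sub>1 (x c) else \<gamma>\<^sub>2 (x c))"
    for c i
  define B where "B i = (if i \<le> n then R else if i = n+1 then dual_norm \<gamma>\<^sub>1 * R else dual_norm \<gamma>\<^sub>2 * R)" for i
  have dom: "dominated M (\<lambda>s. f s (c (node n s)))" if c: "\<And>j. j < n+3 \<Longrightarrow> \<bar>c j\<bar> \<le> B j" for c
  proof (rule superposition_node_dominated)
    fix i assume "i \<le> n" then show "\<bar>c i\<bar> \<le> R" using c[of i] by (simp add: B_def)
  qed
  have x_CBV: "x c \<in> CBV" if c: "\<And>j. j < n+3 \<Longrightarrow> \<bar>c j\<bar> \<le> B j" for c
    unfolding x_def by (rule trial_in_CBV[OF dom[OF c]])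
  have x_norm: "BV_norm (x c) \<le> R" if c: "\<And>j. j < n+3 \<Longrightarrow> \<bar>c j\<bar> \<le> B j" for c
    unfolding x_def using c[of "n+1"] c[of "n+2"]
    by (intro BV_norm_trial_le dom c) (simp_all add: B_def)
  obtain c where c: "\<And>i. i < n+3 \<Longrightarrow> \<bar>c i\<bar> \<le> B i" "\<And>i. i < n+3 \<Longrightarrow> F c i = c i"
  proof (rule brouwer_box_nat[of "n+3" B F])
    fix c :: "nat \<Rightarrow> real" and i assume c: "\<And>j. j < n+3 \<Longrightarrow> \<bar>c j\<bar> \<le> B j" and "i < n+3"
    have "\<bar>\<gamma> (x c)\<bar> \<le> dual_norm \<gamma> * R" if "\<gamma> \<in> CBV_dual" for \<gamma>
      using dual_norm_bound[OF that x_CBV[OF c]] mult_left_mono[OF x_norm[OF c] dual_norm_nonneg[OF that]]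
      by linarith
    moreover have "\<bar>x c t\<bar> \<le> R" for t
      using abs_le_BV_norm[OF x_CBV[OF c]] x_norm[OF c] by (rule order_trans)
    ultimately show "\<bar>F c i\<bar> \<le> B i"
      using dual by (simp add: F_def B_def)
  next
    fix X :: "nat \<Rightarrow> nat \<Rightarrow> real" and c i
    assume X: "\<And>k j. j < n+3 \<Longrightarrow> \<bar>X k j\<bar> \<le> B j" and c: "\<And>j. j < n+3 \<Longrightarrow> \<bar>c j\<bar> \<le> B j"
      and lim: "\<And>j. j < n+3 \<Longrightarrow> (\<lambda>k. X k j) \<longlonglongrightarrow> c j" and i: "i < n+3"
    \<comment> \<open>Convergence in BV norm settles all coordinates of \<open>F\<close> at once:
      grid values and functionals are both continuous in that norm.\<close>
    have conv: "(\<lambda>k. BV_norm (\<lambda>t. x (X k) t - x c t)) \<longlonglongrightarrow> 0"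
      unfolding x_def
    proof (rule trial_tendsto)
      show "AE s in unit_lebesgue. (\<lambda>k. f s (X k (node n s))) \<longlonglongrightarrow> f s (c (node n s))"
        using f_continuous AE_space
      proof eventually_elim
        fix s assume cont: "continuous_on UNIV (f s)" and "s \<in> space unit_lebesgue"
        then have "node n s < n+3" using node_le[of s n] by simp
        from lim[OF this] show "(\<lambda>k. f s (X k (node n s))) \<longlonglongrightarrow> f s (c (node n s))"
          by (intro continuous_on_tendsto_compose[OF cont]) auto
      qed
    qed (intro lim dom X c; simp)+
    have "(\<lambda>k. \<gamma> (x (X k))) \<longlonglongrightarrow> \<gamma> (x c)" if "\<gamma> \<in> CBV_dual" for \<gamma>
      by (rule CBV_dual_tendsto[OF that x_CBV[OF X] x_CBV[OF c] conv])
    moreover have "(\<lambda>k. x (X k) t) \<longlonglongrightarrow> x c t" for t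
      by (rule BV_norm_tendsto_pointwise[OF x_CBV[OF X] x_CBV[OF c] conv])
    ultimately show "(\<lambda>k. F (X k) i) \<longlonglongrightarrow> F c i"
      using dual by (simp add: F_def)
  next
    fix i show "0 \<le> B i" using R_nonneg dual by (simp add: B_def dual_norm_nonneg)
  qed auto
  have "c (n+1) = \<gamma>\<^sub>1 (x c)" "c (n+2) = \<gamma>\<^sub>2 (x c)"
    using c(2)[of "n+1"] c(2)[of "n+2"] by (simp_all add: F_def)
  \<comment> \<open>The integrands agree only for s in [0,1], where \<open>node n s\<close> is a
    valid coordinate, so the images under \<open>int_op\<close> are compared.\<close>
  moreover have "int_op (\<lambda>s. f s (c (node n s))) = int_op (\<lambda>s. f s (x c (real (node n s) / real n)))"
  proof
    fix t
    have "c (node n s) = x c (real (node n s) / real n)" if "s \<in> {0..1}" for s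
      using c(2)[of "node n s"] node_le[OF that, of n] by (simp add: F_def)
    then show "int_op (\<lambda>s. f s (c (node n s))) t = int_op (\<lambda>s. f s (x c (real (node n s) / real n))) t"
      unfolding int_op_def by (intro if_cong refl Bochner_Integration.integral_cong) auto
  qed
  ultimately have "x c = trial (\<gamma>\<^sub>1 (x c)) (\<gamma>\<^sub>2 (x c)) (\<lambda>s. f s (x c (real (node n s) / real n)))"
    unfolding trial_def[abs_def] by (metis x_def trial_def)
  then show ?thesis using that x_CBV[OF c(1)] x_norm[OF c(1)] by blast
qed

text \<open>Uniform convergence of the approximations is not enough, because the functionals are
  continuous only in BV norm. It is used to identify the limit of the superpositions, and the
  smoothing by the kernel then supplies BV convergence.\<close>

theorem solution_exists:
  "\<exists>x\<in>CBV. x = trial (\<gamma>\<^sub>1 x) (\<gamma>\<^sub>2 x) (\<lambda>s. f s (x s))"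
proof -
  define \<tau> where "\<tau> n s = real (node (Suc n) s) / real (Suc n)" for n s
  have \<tau>01: "\<tau> n s \<in> {0..1}" if "s \<in> {0..1}" for n s
    using node_le[OF that, of "Suc n"] by (simp add: \<tau>_def del: of_nat_Suc)
  have "\<exists>x. x \<in> CBV \<and> BV_norm x \<le> R \<and> x = trial (\<gamma>\<^sub>1 x) (\<gamma>\<^sub>2 x) (\<lambda>s. f s (x (\<tau> n s)))" for n
    unfolding \<tau>_def using discretised_solution[of "Suc n"] by blast
  then obtain x where x: "\<And>n. x n \<in> CBV" and x_norm: "\<And>n. BV_norm (x n) \<le> R"
    and x_eq: "\<And>n. x n = trial (\<gamma>\<^sub>1 (x n)) (\<gamma>\<^sub>2 (x n)) (\<lambda>s. f s (x n (\<tau> n s)))"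
    by metis
  define g where "g n s = f s (x n (\<tau> n s))" for n s
  have x_le: "\<bar>x n t\<bar> \<le> R" for n t
    using abs_le_BV_norm[OF x] x_norm by (rule order_trans)
  have g_dom: "dominated M (g n)" for n
    using superposition_node_dominated[of "Suc n" "\<lambda>i. x n (real i / real (Suc n))"] x_le
    by (simp add: g_def[abs_def] \<tau>_def del: of_nat_Suc)
  \<comment> \<open>Compactness is needed only for the integral part; the remaining part of
    \<open>x n\<close> is spanned by two fixed functions with bounded coefficients.\<close>
  obtain y r where y: "continuous_on {0..1} y" and r: "strict_mono (r :: nat \<Rightarrow> nat)"
    and unif: "\<And>e. 0 < e \<Longrightarrow> \<exists>N. \<forall>n t. n \<ge> N \<and> t \<in> {0..1} \<longrightarrow> norm (int_op (g (r n)) t - y t) < e"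
  proof (rule Arzela_Ascoli[of "{0..1::real}" "\<lambda>n. int_op (g n)" "M * weight_mass"])
    show "norm (int_op (g n) t) \<le> M * weight_mass" for n t
      using abs_le_BV_norm[OF int_op_in_CBV[OF g_dom]] BV_norm_int_op_le[OF g_dom]
      by (metis order_trans real_norm_def)
    fix t e :: real assume t: "t \<in> {0..1}" and e: "0 < e"
    have "((\<lambda>s. M * integral\<^sup>L unit_lebesgue (\<lambda>\<sigma>. \<bar>k s \<sigma> - k t \<sigma>\<bar> * \<phi> \<sigma>)) \<longlongrightarrow> 0) (at t within {0..1})"
      by (rule tendsto_mult_right_zero[OF k_continuous[OF t]])
    from tendstoD[OF this e]
    obtain d where d: "0 < d" and
      small: "\<And>s. s \<in> {0..1} \<Longrightarrow> s \<noteq> t \<Longrightarrow> dist s t < d \<Longrightarrow>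
         \<bar>M * integral\<^sup>L unit_lebesgue (\<lambda>\<sigma>. \<bar>k s \<sigma> - k t \<sigma>\<bar> * \<phi> \<sigma>)\<bar> < e"
      unfolding eventually_at dist_real_def by auto
    have "norm (int_op (g n) t - int_op (g n) s) < e" if "s \<in> {0..1}" "norm (t - s) < d" for n s
    proof (cases "s = t")
      case False
      have "\<bar>int_op (g n) s - int_op (g n) t\<bar>
          \<le> M * integral\<^sup>L unit_lebesgue (\<lambda>\<sigma>. \<bar>k s \<sigma> - k t \<sigma>\<bar> * \<phi> \<sigma>)"
        by (rule int_op_modulus[OF that(1) t g_dom])
      also have "\<dots> < e"
        using small[OF that(1) False] that(2) by (simp add: dist_real_def abs_minus_commute abs_less_iff)
      finally show ?thesis by (simp add: abs_minus_commute)
    qed (use e in simp)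
    with d show "\<exists>d. 0 < d \<and> (\<forall>n s. s \<in> {0..1} \<and> norm (t - s) < d \<longrightarrow>
        norm (int_op (g n) t - int_op (g n) s) < e)"
      by blast
  qed auto
  have functional_le: "\<bar>\<gamma> (x n)\<bar> \<le> dual_norm \<gamma> * R" if "\<gamma> \<in> CBV_dual" for \<gamma> n
    using dual_norm_bound[OF that x] mult_left_mono[OF x_norm dual_norm_nonneg[OF that]]
    by (rule order_trans)
  \<comment> \<open>The two functionals are packed into one sequence of vectors to obtain a common
    subsequence.\<close>
  define C where "C n i = (if i = 0 then \<gamma>\<^sub>1 (x (r n)) else \<gamma>\<^sub>2 (x (r n)))" for n and i :: nat
  have "\<bar>C n i\<bar> \<le> max (dual_norm \<gamma>\<^sub>1 * R) (dual_norm \<gamma>\<^sub>2 * R)" for n i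
    using functional_le[OF dual(1), of "r n"] functional_le[OF dual(2), of "r n"] by (auto simp: C_def)
  then obtain r' where r': "strict_mono r'" and C: "\<And>i. i < 2 \<Longrightarrow> convergent (\<lambda>n. C (r' n) i)"
    using bounded_sequences_common_subsequence[of 2 C "max (dual_norm \<gamma>\<^sub>1 * R) (dual_norm \<gamma>\<^sub>2 * R)"]
    by blast
  define \<rho> where "\<rho> = r \<circ> r'"
  have \<rho>: "strict_mono \<rho>" unfolding \<rho>_def by (rule strict_mono_o[OF r r'])
  obtain a b where a: "(\<lambda>n. \<gamma>\<^sub>1 (x (\<rho> n))) \<longlonglongrightarrow> a" and b: "(\<lambda>n. \<gamma>\<^sub>2 (x (\<rho> n))) \<longlonglongrightarrow> b"
    using C[of 0] C[of 1] by (auto simp: C_def \<rho>_def convergent_def)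
  \<comment> \<open>A preliminary limit: at this point it is not known to have bounded variation,
    and \<open>y\<close> is unspecified outside [0,1].\<close>
  define X where "X t = a * e\<^sub>1 t + b * e\<^sub>2 t + y t" for t
  have lim: "(\<lambda>n. x (\<rho> n) (\<sigma> n)) \<longlonglongrightarrow> X s"
    if \<sigma>: "\<And>n. \<sigma> n \<in> {0..1}" "\<sigma> \<longlonglongrightarrow> s" and s: "s \<in> {0..1}" for \<sigma> s
  proof -
    have cont: "(\<lambda>n. h (\<sigma> n)) \<longlonglongrightarrow> h s" if "continuous_on {0..1} h" for h :: "real \<Rightarrow> real"
      using continuous_on_tendsto_compose[OF that \<sigma>(2) s] \<sigma>(1) by simp
    have "(\<lambda>n. int_op (g (\<rho> n)) (\<sigma> n) - y (\<sigma> n)) \<longlonglongrightarrow> 0"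
    proof (rule LIMSEQ_I)
      fix e :: real assume "0 < e"
      then obtain N where N: "\<forall>n t. n \<ge> N \<and> t \<in> {0..1} \<longrightarrow> norm (int_op (g (r n)) t - y t) < e"
        using unif by blast
      \<comment> \<open>Since \<open>r' n\<close> is at least \<open>n\<close>, the index
        \<open>N\<close> found for \<open>r\<close> also serves the further subsequence.\<close>
      have "norm (int_op (g (\<rho> n)) (\<sigma> n) - y (\<sigma> n) - 0) < e" if "n \<ge> N" for n
        using N \<sigma>(1) order_trans[OF that seq_suble[OF r']] by (simp add: \<rho>_def)
      then show "\<exists>N. \<forall>n\<ge>N. norm (int_op (g (\<rho> n)) (\<sigma> n) - y (\<sigma> n) - 0) < e" by blast
    qed
    from tendsto_add[OF this cont[OF y]]
    have "(\<lambda>n. int_op (g (\<rho> n)) (\<sigma> n)) \<longlonglongrightarrow> y s" by simp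
    then have "(\<lambda>n. \<gamma>\<^sub>1 (x (\<rho> n)) * e\<^sub>1 (\<sigma> n) + \<gamma>\<^sub>2 (x (\<rho> n)) * e\<^sub>2 (\<sigma> n) + int_op (g (\<rho> n)) (\<sigma> n)) \<longlonglongrightarrow> X s"
      unfolding X_def using CBV by (intro tendsto_intros a b cont) (simp_all add: CBV_def)
    moreover have "x n t = \<gamma>\<^sub>1 (x n) * e\<^sub>1 t + \<gamma>\<^sub>2 (x n) * e\<^sub>2 t + int_op (g n) t" for n t
      using fun_cong[OF x_eq, of n t] by (simp add: trial_def g_def[abs_def])
    ultimately show ?thesis by simp
  qed
  have X_le: "\<bar>X s\<bar> \<le> R" if "s \<in> {0..1}" for s
  proof (rule LIMSEQ_le_const2)
    show "(\<lambda>n. \<bar>x (\<rho> n) s\<bar>) \<longlonglongrightarrow> \<bar>X s\<bar>"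
      using that by (intro tendsto_rabs lim) auto
  qed (use x_le in blast)
  have g_lim: "AE s in unit_lebesgue. (\<lambda>n. g (\<rho> n) s) \<longlonglongrightarrow> f s (X s)"
    using f_continuous AE_space
  proof eventually_elim
    fix s assume cont: "continuous_on UNIV (f s)" and "s \<in> space unit_lebesgue"
    then have s: "s \<in> {0..1}" by simp
    have "(\<lambda>n. x (\<rho> n) (\<tau> (\<rho> n) s)) \<longlonglongrightarrow> X s"
      using node_tendsto[OF s \<rho>] by (intro lim \<tau>01 s) (simp add: \<tau>_def)
    then show "(\<lambda>n. g (\<rho> n) s) \<longlonglongrightarrow> f s (X s)"
      unfolding g_def by (intro continuous_on_tendsto_compose[OF cont]) auto
  qed
  have G_dom: "dominated M (\<lambda>s. f s (X s))"
    unfolding dominated_def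
  proof
    show "(\<lambda>s. f s (X s)) \<in> borel_measurable unit_lebesgue"
      by (rule lebesgue_on_borel_measurable_LIMSEQ_AE[OF _ dominated_measurable[OF g_dom] g_lim]) simp
  qed (use f_dominated X_le in blast)
  \<comment> \<open>Rebuilding the limit through \<open>trial\<close> gives a function that lies in
    \<open>CBV\<close> and agrees with \<open>X\<close> on [0,1].\<close>
  define z where "z = trial a b (\<lambda>s. f s (X s))"
  have z: "z \<in> CBV" unfolding z_def by (rule trial_in_CBV[OF G_dom])
  have "(\<lambda>n. BV_norm (\<lambda>t. trial (\<gamma>\<^sub>1 (x (\<rho> n))) (\<gamma>\<^sub>2 (x (\<rho> n))) (g (\<rho> n)) t - z t)) \<longlonglongrightarrow> 0"
    unfolding z_def by (rule trial_tendsto[OF a b g_dom G_dom g_lim])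
  then have conv: "(\<lambda>n. BV_norm (\<lambda>t. x (\<rho> n) t - z t)) \<longlonglongrightarrow> 0"
    using x_eq by (simp add: g_def[abs_def])
  have "z t = X t" if "t \<in> {0..1}" for t
    using BV_norm_tendsto_pointwise[OF x z conv, of t] lim[of "\<lambda>_. t" t] that
    by (auto intro: LIMSEQ_unique)
  then have "int_op (\<lambda>s. f s (X s)) = int_op (\<lambda>s. f s (z s))"
    unfolding int_op_def by (intro ext if_cong refl Bochner_Integration.integral_cong) auto
  moreover have "a = \<gamma>\<^sub>1 z" "b = \<gamma>\<^sub>2 z"
    using LIMSEQ_unique[OF a CBV_dual_tendsto[OF dual(1) x z conv]]
      LIMSEQ_unique[OF b CBV_dual_tendsto[OF dual(2) x z conv]] by auto
  ultimately have "z = trial (\<gamma>\<^sub>1 z) (\<gamma>\<^sub>2 z) (\<lambda>s. f s (z s))"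
    by (metis z_def trial_def ext)
  with z show ?thesis by blast
qed

end

section \<open>Choice of the radius and deduction of the existence theorem\<close>

theorem theorem4p9:
  fixes \<alpha> \<beta> :: "(real \<Rightarrow> real) \<Rightarrow> real"
    and v w :: "real \<Rightarrow> real"
    and p :: ereal and q :: real
    and f :: "real \<Rightarrow> real \<Rightarrow> real"
    and \<psi> \<phi> :: "real \<Rightarrow> real"
    and k :: "real \<Rightarrow> real \<Rightarrow> real"
    and m :: "real \<Rightarrow> real"
  assumes alpha: "\<alpha> \<in> CBV_dual" and beta: "\<beta> \<in> CBV_dual"
    and v: "v \<in> CBV" and w: "w \<in> CBV"
    and vw: "\<forall>t\<in>{0..1}. v t + w t = 1"
    and small: "dual_norm \<alpha> + dual_norm (\<lambda>x. \<alpha> x - \<beta> x) * BV_norm w < 1"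
    and p: "1 < p" and q: "1 \<le> q"
    and pq: "inverse p + ereal (1 / q) = 1"
    and f_meas: "\<forall>u. (\<lambda>t. f t u) \<in> borel_measurable (lebesgue_on {0..1})"
    and f_cont: "AE t in lebesgue_on {0..1}. continuous_on UNIV (\<lambda>u. f t u)"
    and psi_mono: "mono_on {0..} \<psi>"
    and psi_nonneg: "\<forall>r\<ge>0. 0 \<le> \<psi> r"
    and phi_Lp: "memLp p \<phi>"
    and phi_nonneg: "\<forall>t\<in>{0..1}. 0 \<le> \<phi> t"
    and f_bound: "\<forall>t\<in>{0..1}. \<forall>u. \<bar>f t u\<bar> \<le> \<phi> t * \<psi> \<bar>u\<bar>"
    and psi_lim: "((\<lambda>r. \<psi> r / r) \<longlongrightarrow> 0) at_top"
    and k_Lq: "\<forall>t\<in>{0..1}. memLp (ereal q) (\<lambda>s. k t s)"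
    and m_Lq: "memLp (ereal q) m"
    and m_nonneg: "\<forall>s\<in>{0..1}. 0 \<le> m s"
    and k_var: "AE s in lebesgue_on {0..1}.
                  bounded_variation (\<lambda>t. k t s) 0 1 \<and> total_variation (\<lambda>t. k t s) 0 1 \<le> m s"
    and k_cont: "\<forall>\<tau>\<in>{0..1}. ((\<lambda>t. integral\<^sup>L (lebesgue_on {0..1}) (\<lambda>s. \<bar>k t s - k \<tau> s\<bar> * \<phi> s))
                    \<longlongrightarrow> 0) (at \<tau> within {0..1})"
  shows "\<exists>x\<in>CBV. \<forall>t\<in>{0..1}.
           x t = \<alpha> x * v t + \<beta> x * w t + integral\<^sup>L (lebesgue_on {0..1}) (\<lambda>s. k t s * f s (x s))"
proof -
  interpret bv_kernel k \<phi> m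
  proof
    show "k t \<in> borel_measurable unit_lebesgue" if "t \<in> {0..1}" for t
      using k_Lq that by (simp add: memLp_def)
    show "m \<in> borel_measurable unit_lebesgue"
      using m_Lq by (simp add: memLp_def)
    show "integrable unit_lebesgue (\<lambda>s. k t s * \<phi> s)" if "t \<in> {0..1}" for t
      using conjugate_exponents_integrable_mult[OF p q pq phi_Lp] k_Lq that by blast
    show "integrable unit_lebesgue (\<lambda>s. m s * \<phi> s)"
      by (rule conjugate_exponents_integrable_mult[OF p q pq phi_Lp m_Lq])
  qed (use phi_nonneg m_nonneg k_var k_cont in auto)
  define \<theta> where "\<theta> = dual_norm \<alpha> + dual_norm (\<lambda>x. \<alpha> x - \<beta> x) * BV_norm w"
  \<comment> \<open>Sublinear growth of \<psi> yields a radius with \<psi>(R)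
    \<open>weight_mass\<close> at most (1 - \<theta>) R. The added 1 keeps the denominator positive
    when \<open>weight_mass\<close> is 0.\<close>
  have "0 < (1 - \<theta>) / (weight_mass + 1)"
    using small weight_mass_nonneg by (simp add: \<theta>_def)
  from order_tendstoD(2)[OF psi_lim this]
  have "\<forall>\<^sub>F r in at_top. \<psi> r / r < (1 - \<theta>) / (weight_mass + 1) \<and> 0 < r"
    using eventually_gt_at_top[of 0] by eventually_elim simp
  then obtain R where R: "0 < R" "\<psi> R / R < (1 - \<theta>) / (weight_mass + 1)"
    unfolding eventually_at_top_linorder by blast
  have "\<psi> R * weight_mass \<le> \<psi> R * (weight_mass + 1)"
    using psi_nonneg R(1) by (intro mult_left_mono) auto
  also have "\<dots> \<le> (1 - \<theta>) * R"
    using R weight_mass_nonneg by (simp add: field_simps)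
  finally have bound: "\<theta> * R + \<psi> R * weight_mass \<le> R"
    by (simp add: left_diff_distrib)
  \<comment> \<open>Substituting v = 1 - w turns the first two terms into \<alpha>[x] 1 + (\<beta> -
    \<alpha>)[x] w. The constant function has norm 1, so the linear part of the estimate is exactly
    \<theta> R.\<close>
  interpret hammerstein_equation k \<phi> m f \<alpha> "\<lambda>x. \<beta> x - \<alpha> x" "indicator {0..1}" w "\<psi> R" R
  proof
    show "(\<lambda>x. \<beta> x - \<alpha> x) \<in> CBV_dual" by (rule diff_in_CBV_dual[OF beta alpha])
    show "\<bar>f s u\<bar> \<le> \<psi> R * \<phi> s" if "s \<in> {0..1}" "\<bar>u\<bar> \<le> R" for s u
    proof -
      have "\<psi> \<bar>u\<bar> \<le> \<psi> R" using psi_mono that(2) R(1) by (intro mono_onD[OF psi_mono]) auto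
      then have "\<phi> s * \<psi> \<bar>u\<bar> \<le> \<phi> s * \<psi> R" using phi_nonneg that(1) by (intro mult_left_mono) auto
      then show ?thesis using f_bound that(1) by (metis mult.commute order_trans)
    qed
    have "dual_norm (\<lambda>x. \<beta> x - \<alpha> x) = dual_norm (\<lambda>x. \<alpha> x - \<beta> x)"
      by (simp add: dual_norm_def abs_minus_commute)
    then show "dual_norm \<alpha> * R * BV_norm (indicator {0..1}) + dual_norm (\<lambda>x. \<beta> x - \<alpha> x) * R * BV_norm w
        + \<psi> R * weight_mass \<le> R"
      using bound by (simp add: BV_norm_indicator \<theta>_def algebra_simps)
  qed (use alpha w R f_meas f_cont indicator_in_CBV in auto)
  obtain x where x: "x \<in> CBV" "x = trial (\<alpha> x) (\<beta> x - \<alpha> x) (\<lambda>s. f s (x s))"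
    using solution_exists by blast
  have "x t = \<alpha> x * v t + \<beta> x * w t + integral\<^sup>L (lebesgue_on {0..1}) (\<lambda>s. k t s * f s (x s))"
    if t: "t \<in> {0..1}" for t
  proof -
    have "x t = \<alpha> x + (\<beta> x - \<alpha> x) * w t + integral\<^sup>L unit_lebesgue (\<lambda>s. k t s * f s (x s))"
      using fun_cong[OF x(2), of t] t by (simp add: trial_def int_op_def)
    moreover have v_eq: "v t = 1 - w t" using vw t by (simp add: algebra_simps)
    ultimately show ?thesis unfolding v_eq by (simp add: algebra_simps)
  qed
  with x(1) show ?thesis by blast
qed

end
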